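(* The variance sequence $(v_N)_{N\ge1}$ is nonincreasing with $v_N\downarrow0$, and there exists a standard Brownian motion $\{W(v),\,v\ge0\}$ with $W(0)=0$ such that $$\bigl(\widehat\theta^{(N)}-\theta\bigr)_{N\ge1}\overset{d}{=}\bigl(W(v_N)\bigr)_{N\ge1}$$ as random elements of the sequence space $\mathbb R^{\mathbb N}$ equipped with its product $\sigma$-field.
   Context: Fix a mesh $h>0$, an integer $m\ge1$ and known Hurst parameters $H_1,\dots,H_m\in(1/2,1)$. Let $B^{H_1},\dots,B^{H_m}$ be independent fractional Brownian motions on one probability space, i.e. independent centred continuous Gaussian processes with $B^{H_r}(0)=0$ and $\mathbb E[B^{H_r}(t)B^{H_r}(s)]=\frac12(t^{2H_r}+s^{2H_r}-|t-s|^{2H_r})$ for $s,t\ge0$. For $\theta\in\mathbb R$ and $\alpha>0$ set $Z(t)=\theta t+\alpha\sum_{r=1}^m B^{H_r}(t)$ and $t_k=kh$. For $N\ge1$ let $\mathbf T_N=(t_1,\dots,t_N)^\top$, $\mathbf Z^{(N)}=(Z(t_1),\dots,Z(t_N))^\top$, and let $\Gamma_{H,N}$ be the $N\times N$ positive definite matrix with entries $\frac12\sum_{r=1}^m(t_i^{2H_r}+t_j^{2H_r}-|t_i-t_j|^{2H_r})$. Put $d_N=\mathbf T_N^\top\Gamma_{H,N}^{-1}\mathbf T_N$, $\widehat\theta^{(N)}=\mathbf T_N^\top\Gamma_{H,N}^{-1}\mathbf Z^{(N)}/d_N$ and $v_N=\mathrm{Var}(\widehat\theta^{(N)})=\alpha^2/d_N$.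 $\overset{d}{=}$ denotes equality in law. *)

theory Defs
  imports "HOL-Probability.Probability" "Jordan_Normal_Form.Gauss_Jordan_Elimination"
begin

context prob_space
begin

text \<open>The second disjunct is the degenerate normal law (a point mass), which must be admitted,
  for instance for the empty linear combination or for a process at time 0.\<close>

definition gaussian_rv :: "('a \<Rightarrow> real) \<Rightarrow> bool" where
  "gaussian_rv X \<longleftrightarrow> random_variable borel X \<and>
     ((\<exists>\<mu> \<sigma>. \<sigma> > 0 \<and> distributed M lborel X (normal_density \<mu> \<sigma>)) \<or>
      (\<exists>\<mu>. AE \<omega> in M. X \<omega> = \<mu>))"

definition gaussian_process :: "real set \<Rightarrow> (real \<Rightarrow> 'a \<Rightarrow> real) \<Rightarrow> bool" where
  "gaussian_process T X \<longleftrightarrow>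
     (\<forall>F c. finite F \<and> F \<subseteq> T \<longrightarrow> gaussian_rv (\<lambda>\<omega>. \<Sum>t\<in>F. c t * X t \<omega>))"

text \<open>Path properties are only required almost surely here, since the notion occurs as a
  hypothesis; for the Brownian motion below, which occurs in a conclusion, they hold surely.\<close>

definition fractional_brownian_motion :: "real \<Rightarrow> (real \<Rightarrow> 'a \<Rightarrow> real) \<Rightarrow> bool" where
  "fractional_brownian_motion H B \<longleftrightarrow>
     gaussian_process {0..} B \<and>
     (AE \<omega> in M. B 0 \<omega> = 0) \<and>
     (AE \<omega> in M. continuous_on {0..} (\<lambda>t. B t \<omega>)) \<and>
     (\<forall>t\<ge>0. expectation (B t) = 0) \<and>
     (\<forall>s\<ge>0. \<forall>t\<ge>0. expectation (\<lambda>\<omega>. B t \<omega> * B s \<omega>) =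
        (t powr (2 * H) + s powr (2 * H) - \<bar>t - s\<bar> powr (2 * H)) / 2)"

text \<open>Mutual independence of whole processes: each one is regarded as a random element of the
  path space over the time set with its product sigma-algebra.\<close>

definition indep_processes :: "'i set \<Rightarrow> ('i \<Rightarrow> real \<Rightarrow> 'a \<Rightarrow> real) \<Rightarrow> bool" where
  "indep_processes I B \<longleftrightarrow>
     indep_vars (\<lambda>_. PiM {0..} (\<lambda>_. borel)) (\<lambda>r \<omega>. \<lambda>t\<in>{0..}. B r t \<omega>) I"

definition standard_brownian_motion :: "(real \<Rightarrow> 'a \<Rightarrow> real) \<Rightarrow> bool" where
  "standard_brownian_motion W \<longleftrightarrow>
     (\<forall>t\<ge>0. random_variable borel (W t)) \<and>
     (\<forall>\<omega>\<in>space M. W 0 \<omega> = 0) \<and>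
     (\<forall>\<omega>\<in>space M. continuous_on {0..} (\<lambda>t. W t \<omega>)) \<and>
     (\<forall>s t. 0 \<le> s \<and> s < t \<longrightarrow>
        distributed M lborel (\<lambda>\<omega>. W t \<omega> - W s \<omega>) (normal_density 0 (sqrt (t - s)))) \<and>
     (\<forall>(n::nat) t. 0 \<le> t 0 \<and> (\<forall>i<n. t i < t (Suc i)) \<longrightarrow>
        indep_vars (\<lambda>_. borel) (\<lambda>i \<omega>. W (t (Suc i)) \<omega> - W (t i) \<omega>) {..<n})"

end

definition drift_process ::
  "real \<Rightarrow> real \<Rightarrow> nat \<Rightarrow> (nat \<Rightarrow> real \<Rightarrow> 'a \<Rightarrow> real) \<Rightarrow> real \<Rightarrow> 'a \<Rightarrow> real" where
  "drift_process \<theta> \<alpha> m B t \<omega> = \<theta> * t + \<alpha> * (\<Sum>r=1..m. B r t \<omega>)"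

text \<open>Vectors and matrices are indexed from 0, so position \<open>i\<close> belongs to the time
  \<open>(i + 1) h\<close>.\<close>

definition grid_time :: "real \<Rightarrow> nat \<Rightarrow> real" where
  "grid_time h k = real k * h"

definition time_vec :: "real \<Rightarrow> nat \<Rightarrow> real vec" where
  "time_vec h N = vec N (\<lambda>i. grid_time h (Suc i))"

definition obs_vec :: "real \<Rightarrow> (real \<Rightarrow> 'a \<Rightarrow> real) \<Rightarrow> nat \<Rightarrow> 'a \<Rightarrow> real vec" where
  "obs_vec h Z N \<omega> = vec N (\<lambda>i. Z (grid_time h (Suc i)) \<omega>)"

definition cov_mat :: "real \<Rightarrow> nat \<Rightarrow> (nat \<Rightarrow> real) \<Rightarrow> nat \<Rightarrow> real mat" where
  "cov_mat h m H N = mat N N (\<lambda>(i, j).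
     let s = grid_time h (Suc i); t = grid_time h (Suc j)
     in (1 / 2) * (\<Sum>r=1..m. s powr (2 * H r) + t powr (2 * H r) - \<bar>s - t\<bar> powr (2 * H r)))"

text \<open>\<open>mat_inverse\<close> returns \<open>None\<close> on singular matrices; the covariance matrix is positive
  definite, hence invertible.\<close>

definition cov_inv :: "real \<Rightarrow> nat \<Rightarrow> (nat \<Rightarrow> real) \<Rightarrow> nat \<Rightarrow> real mat" where
  "cov_inv h m H N = the (mat_inverse (cov_mat h m H N))"

definition info :: "real \<Rightarrow> nat \<Rightarrow> (nat \<Rightarrow> real) \<Rightarrow> nat \<Rightarrow> real" where
  "info h m H N = scalar_prod (time_vec h N) (cov_inv h m H N *\<^sub>v time_vec h N)"

definition drift_estimator ::
  "real \<Rightarrow> nat \<Rightarrow> (nat \<Rightarrow> real) \<Rightarrow> (real \<Rightarrow> 'a \<Rightarrow> real) \<Rightarrow> nat \<Rightarrow> 'a \<Rightarrow> real" where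
  "drift_estimator h m H Z N \<omega> =
     scalar_prod (time_vec h N) (cov_inv h m H N *\<^sub>v obs_vec h Z N \<omega>) / info h m H N"

end

theory Submission
  imports Defs "HOL-Real_Asymp.Real_Asymp" "Jordan_Normal_Form.Determinant"
begin

text \<open>The estimator is the best linear unbiased one: by the normal equations its covariance with any
  unbiased combination of the first \<open>N\<close> observations equals its variance. Hence the centred estimators
  form a Gaussian sequence with covariance \<open>v (max N K) = min (v N) (v K)\<close>, which is the covariance of
  \<open>W (v N)\<close>; the two laws agree by the Cramer-Wold argument. Comparing with the unbiased estimator
  \<open>Z(t_N) / t_N\<close> shows that \<open>v\<close> tends to 0. Invertibility of the covariance matrix comes from the kink of
  \<open>|t - s|^(2 H)\<close> on the diagonal, and \<open>W\<close> is built from its Schauder expansion.\<close>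

section \<open>Joint characteristic functions\<close>

text \<open>All Gaussian information passes through one identity: the expectation of
  \<open>iexp\<close> of a linear combination is \<open>exp (- Q / 2)\<close>, where
  \<open>Q\<close> is the quadratic form of the covariance. It is proved for the noise, the bridge,
  the Brownian motion and the observations; laws, independence of increments and the value of
  \<open>v N\<close> are then read off from it. Joint densities never occur, so singular
  covariances, such as those of \<open>W\<close> at repeated times, need no separate case. Since
  only equality in law is claimed, \<open>W\<close> is built on a space of its own, from independent
  coordinates of a product space, and need not be found on \<open>M\<close>. The Schauder series is
  summed for the bridge on [0, 1) only; a time change then gives all of [0, infinity) at once,
  without pasting intervals together.\<close>

lemma char_weighted_distr:
  fixes X w :: "'a \<Rightarrow> real"
  assumes "prob_space M" and [measurable]: "X \<in> borel_measurable M" "w \<in> borel_measurable M"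
    and w: "\<And>x. 0 \<le> w x" "\<And>x. w x \<le> C" and c: "c = (LINT x|M. w x)" "c > 0"
  defines "D \<equiv> distr (density M (\<lambda>x. ennreal (w x / c))) borel X"
  shows "real_distribution D"
    and "char D t = (CLINT x|M. of_real (w x) * iexp (t * X x)) / c"
    and "A \<in> sets borel \<Longrightarrow> measure D A = (LINT x|M. w x * indicator A (X x)) / c"
proof -
  interpret prob_space M by fact
  have int: "integrable M w"
    by (rule integrable_const_bound[where B = C]) (use w in auto)
  have "prob_space (density M (\<lambda>x. ennreal (w x / c)))"
  proof (rule prob_spaceI)
    have "(\<integral>\<^sup>+x. ennreal (w x / c) \<partial>M) = ennreal (LINT x|M. w x / c)"
      using int w c by (intro nn_integral_eq_integral) auto
    also have "\<dots> = 1" using c by simp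
    finally show "emeasure (density M (\<lambda>x. ennreal (w x / c))) (space (density M (\<lambda>x. ennreal (w x / c)))) = 1"
      by (simp add: emeasure_density cong: nn_integral_cong)
  qed
  then interpret E: prob_space "density M (\<lambda>x. ennreal (w x / c))" .
  show D: "real_distribution D" unfolding D_def by (rule E.real_distribution_distr) simp
  interpret D: real_distribution D by fact
  show "char D t = (CLINT x|M. of_real (w x) * iexp (t * X x)) / c"
  proof -
    have "char D t = (CLINT x|M. (w x / c) *\<^sub>R iexp (t * X x))"
      unfolding D_def char_def using w c
      by (subst integral_distr) (auto simp: integral_density)
    also have "\<dots> = (CLINT x|M. of_real (w x) * iexp (t * X x) / c)"
      by (simp add: scaleR_conv_of_real field_simps)
    finally show ?thesis by simp
  qed
  assume [measurable]: "A \<in> sets borel"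
  have "measure D A = (LINT x|D. indicator A x)" by simp
  also have "\<dots> = (LINT x|M. (w x / c) *\<^sub>R indicator A (X x))"
    unfolding D_def using w c by (subst integral_distr) (auto simp: integral_density)
  also have "\<dots> = (LINT x|M. w x * indicator A (X x) / c)" by simp
  finally show "measure D A = (LINT x|M. w x * indicator A (X x)) / c" by simp
qed

text \<open>A change of measure reduces this to uniqueness for probability laws: under the density
  \<open>w / c\<close> the characteristic function of \<open>X\<close> is the weighted integral
  divided by \<open>c\<close>. The hypothesis at \<open>t = 0\<close> says that both weights have
  the same mass \<open>c\<close>, so one normalisation serves both sides. If the mass is 0 there is
  no such law, but then both weights vanish almost everywhere.\<close>

lemma weighted_Levy_uniqueness:
  fixes X w :: "'a \<Rightarrow> real" and Y w' :: "'b \<Rightarrow> real"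
  assumes M: "prob_space M" and N: "prob_space N"
    and [measurable]: "X \<in> borel_measurable M" "w \<in> borel_measurable M"
      "Y \<in> borel_measurable N" "w' \<in> borel_measurable N"
    and w: "\<And>x. 0 \<le> w x" "\<And>x. w x \<le> C" and w': "\<And>x. 0 \<le> w' x" "\<And>x. w' x \<le> C"
    and eq: "\<And>t. (CLINT x|M. of_real (w x) * iexp (t * X x)) = (CLINT y|N. of_real (w' y) * iexp (t * Y y))"
    and A [measurable]: "A \<in> sets borel"
  shows "(LINT x|M. w x * indicator A (X x)) = (LINT y|N. w' y * indicator A (Y y))"
proof -
  interpret M: prob_space M by fact
  interpret N: prob_space N by fact
  define c where "c = (LINT x|M. w x)"
  have c': "c = (LINT x|N. w' x)"
    using eq[of 0] unfolding c_def by (simp add: integral_complex_of_real)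
  have int: "integrable M w" "integrable N w'"
    by (rule M.integrable_const_bound[where B = C] N.integrable_const_bound[where B = C]; use w w' in auto)+
  show ?thesis
  proof (cases "c = 0")
    case True
    have "AE x in M. w x = 0" using True int w by (simp add: c_def integral_nonneg_eq_0_iff_AE)
    then have "(LINT x|M. w x * indicator A (X x)) = (LINT x|M. 0)"
      by (intro integral_cong_AE) auto
    moreover have "AE x in N. w' x = 0" using True int w' by (simp add: c' integral_nonneg_eq_0_iff_AE)
    then have "(LINT x|N. w' x * indicator A (Y x)) = (LINT x|N. 0)"
      by (intro integral_cong_AE) auto
    ultimately show ?thesis by simp
  next
    case False
    then have c0: "c > 0" using w by (simp add: c_def order_less_le)
    note 1 = char_weighted_distr[OF M _ _ w c_def c0, of X]
      and 2 = char_weighted_distr[OF N _ _ w' c' c0, of Y]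
    have "distr (density M (\<lambda>x. ennreal (w x / c))) borel X
        = distr (density N (\<lambda>x. ennreal (w' x / c))) borel Y"
    proof (intro Levy_uniqueness 1 2 ext)
      show "char (distr (density M (\<lambda>x. ennreal (w x / c))) borel X) t
        = char (distr (density N (\<lambda>x. ennreal (w' x / c))) borel Y) t" for t
        by (subst 1(2), simp, simp, subst 2(2), simp, simp, simp only: eq)
    qed simp_all
    then show ?thesis using 1(3)[of A] 2(3)[of A] c0 by simp
  qed
qed

lemma iexp_eq_Complex: "iexp x = Complex (cos x) (sin x)"
  by (simp add: cis_conv_exp[symmetric] cis.ctr)

text \<open>The complex weight \<open>u * iexp \<phi>\<close> is split into the nonnegative weights \<open>u\<close>, \<open>u * (1 + cos \<phi>)\<close> and
  \<open>u * (1 + sin \<phi>)\<close>, for each of which the one-dimensional uniqueness theorem applies to the law of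
  \<open>X\<close>. Iterating this trades the variables in the exponent for indicators one at a time.\<close>

lemma integral_weighted_iexp_eq:
  fixes X \<phi> u :: "'a \<Rightarrow> real" and Y \<psi> u' :: "'b \<Rightarrow> real"
  assumes M: "prob_space M" and N: "prob_space N"
    and [measurable]: "X \<in> borel_measurable M" "u \<in> borel_measurable M" "\<phi> \<in> borel_measurable M"
      "Y \<in> borel_measurable N" "u' \<in> borel_measurable N" "\<psi> \<in> borel_measurable N"
    and u: "\<And>x. 0 \<le> u x" "\<And>x. u x \<le> 1" and u': "\<And>x. 0 \<le> u' x" "\<And>x. u' x \<le> 1"
    and eq: "\<And>s t. (CLINT x|M. of_real (u x) * iexp (s * X x + t * \<phi> x))
                 = (CLINT y|N. of_real (u' y) * iexp (s * Y y + t * \<psi> y))"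
    and A [measurable]: "A \<in> sets borel"
  shows "(CLINT x|M. of_real (u x * indicator A (X x)) * iexp (\<phi> x))
       = (CLINT y|N. of_real (u' y * indicator A (Y y)) * iexp (\<psi> y))"
proof -
  interpret M: prob_space M by fact
  interpret N: prob_space N by fact
  have intM: "integrable M (\<lambda>x. of_real (u x) * iexp (f x))" if [measurable]: "f \<in> borel_measurable M" for f
    by (rule M.integrable_const_bound[where B = 1]) (use u in \<open>auto simp: norm_mult\<close>)
  have intN: "integrable N (\<lambda>x. of_real (u' x) * iexp (f x))" if [measurable]: "f \<in> borel_measurable N" for f
    by (rule N.integrable_const_bound[where B = 1]) (use u' in \<open>auto simp: norm_mult\<close>)
  have intM': "integrable M (\<lambda>x. u x * f x)" if [measurable]: "f \<in> borel_measurable M" and "\<And>x. \<bar>f x\<bar> \<le> 1" for f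
    by (rule M.integrable_const_bound[where B = 1]) (use u that in \<open>auto simp: abs_mult intro!: mult_le_one\<close>)
  have intN': "integrable N (\<lambda>x. u' x * f x)" if [measurable]: "f \<in> borel_measurable N" and "\<And>x. \<bar>f x\<bar> \<le> 1" for f
    by (rule N.integrable_const_bound[where B = 1]) (use u' that in \<open>auto simp: abs_mult intro!: mult_le_one\<close>)
  \<comment> \<open>A factor \<open>1 + cos p\<close> or \<open>1 + sin p\<close> shifts the
    exponent \<open>q\<close> by \<open>p\<close> and by \<open>- p\<close>. So the reweighted
    characteristic functions involve \<open>\<phi>\<close> only with the factors 0, 1 and -1, the
    instances of the hypothesis collected in \<open>e\<close>.\<close>
  have expand_cos: "of_real (a * (1 + cos p)) * iexp q =
      of_real a * iexp q + (1/2) * (of_real a * iexp (q + p)) + (1/2) * (of_real a * iexp (q - p))" for a p q :: real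
    unfolding iexp_eq_Complex by (simp add: complex_eq_iff cos_add sin_add cos_diff sin_diff field_simps)
  have expand_sin: "of_real (a * (1 + sin p)) * iexp q =
      of_real a * iexp q - (\<i>/2) * (of_real a * iexp (q + p)) + (\<i>/2) * (of_real a * iexp (q - p))" for a p q :: real
    unfolding iexp_eq_Complex by (simp add: complex_eq_iff cos_add sin_add cos_diff sin_diff field_simps)
  have e: "(CLINT x|M. of_real (u x) * iexp (s * X x)) = (CLINT y|N. of_real (u' y) * iexp (s * Y y))"
    "(CLINT x|M. of_real (u x) * iexp (s * X x + \<phi> x)) = (CLINT y|N. of_real (u' y) * iexp (s * Y y + \<psi> y))"
    "(CLINT x|M. of_real (u x) * iexp (s * X x - \<phi> x)) = (CLINT y|N. of_real (u' y) * iexp (s * Y y - \<psi> y))" for s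
    using eq[of s 0] eq[of s 1] eq[of s "-1"] by (simp_all del: of_real_mult)
  have cos_bd: "0 \<le> a * (1 + cos p)" "a * (1 + cos p) \<le> 2" "0 \<le> a * (1 + sin p)" "a * (1 + sin p) \<le> 2"
    if "0 \<le> a" "a \<le> 1" for a p :: real
  proof -
    have "0 \<le> 1 + cos p" "0 \<le> 1 + sin p" "1 + cos p \<le> 2" "1 + sin p \<le> 2"
      using cos_ge_minus_one[of p] sin_ge_minus_one[of p] cos_le_one[of p] sin_le_one[of p] by linarith+
    then show "0 \<le> a * (1 + cos p)" "a * (1 + cos p) \<le> 2" "0 \<le> a * (1 + sin p)" "a * (1 + sin p) \<le> 2"
      using that mult_mono[of a 1 "1 + cos p" 2] mult_mono[of a 1 "1 + sin p" 2] by simp_all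
  qed
  have 0: "(LINT x|M. u x * indicator A (X x)) = (LINT y|N. u' y * indicator A (Y y))"
    by (rule weighted_Levy_uniqueness[OF M N, where C = 1]) (use u u' e in auto)

  have ints: "integrable M (\<lambda>x. of_real (u x) * iexp (s * X x))"
    "integrable M (\<lambda>x. of_real (u x) * iexp (s * X x + \<phi> x))"
    "integrable M (\<lambda>x. of_real (u x) * iexp (s * X x - \<phi> x))"
    "integrable N (\<lambda>x. of_real (u' x) * iexp (s * Y x))"
    "integrable N (\<lambda>x. of_real (u' x) * iexp (s * Y x + \<psi> x))"
    "integrable N (\<lambda>x. of_real (u' x) * iexp (s * Y x - \<psi> x))" for s
    by (rule intM intN; measurable)+
  have 1: "(LINT x|M. u x * (1 + cos (\<phi> x)) * indicator A (X x))
      = (LINT y|N. u' y * (1 + cos (\<psi> y)) * indicator A (Y y))"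
  proof (rule weighted_Levy_uniqueness[OF M N, where C = 2])
    show "(CLINT x|M. of_real (u x * (1 + cos (\<phi> x))) * iexp (t * X x))
        = (CLINT y|N. of_real (u' y * (1 + cos (\<psi> y))) * iexp (t * Y y))" for t
      unfolding expand_cos
      by (simp only: Bochner_Integration.integral_add integral_mult_right_zero ints e
         Bochner_Integration.integrable_add integrable_mult_right)
  qed (use u u' cos_bd in \<open>auto simp del: distrib_left\<close>)
  have 2: "(LINT x|M. u x * (1 + sin (\<phi> x)) * indicator A (X x))
      = (LINT y|N. u' y * (1 + sin (\<psi> y)) * indicator A (Y y))"
  proof (rule weighted_Levy_uniqueness[OF M N, where C = 2])
    show "(CLINT x|M. of_real (u x * (1 + sin (\<phi> x))) * iexp (t * X x))
        = (CLINT y|N. of_real (u' y * (1 + sin (\<psi> y))) * iexp (t * Y y))" for t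
      unfolding expand_sin
      by (simp only: Bochner_Integration.integral_add Bochner_Integration.integral_diff integral_mult_right_zero ints e
         Bochner_Integration.integrable_diff integrable_mult_right)
  qed (use u u' cos_bd in \<open>auto simp del: distrib_left\<close>)
  have bd: "\<bar>f * indicator S x\<bar> \<le> 1" if "\<bar>f\<bar> \<le> 1" for f x :: real and S
    using that by (auto simp: indicator_def)
  have iM: "integrable M (\<lambda>x. u x * (f x * indicator A (X x)))"
    if [measurable]: "f \<in> borel_measurable M" and "\<And>x. \<bar>f x\<bar> \<le> 1" for f
    by (rule intM'[OF _ bd[OF that(2)]]) measurable
  have iN: "integrable N (\<lambda>x. u' x * (f x * indicator A (Y x)))"
    if [measurable]: "f \<in> borel_measurable N" and "\<And>x. \<bar>f x\<bar> \<le> 1" for f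
    by (rule intN'[OF _ bd[OF that(2)]]) measurable
  \<comment> \<open>The signed weights are recovered from the nonnegative ones by subtracting the
    identity for \<open>u\<close> alone.\<close>
  have c: "(LINT x|M. u x * (cos (\<phi> x) * indicator A (X x))) = (LINT y|N. u' y * (cos (\<psi> y) * indicator A (Y y)))"
    using 0 1 iM[of "\<lambda>_. 1"] iN[of "\<lambda>_. 1"] iM[of "\<lambda>x. cos (\<phi> x)"] iN[of "\<lambda>x. cos (\<psi> x)"]
    by (simp add: algebra_simps)
  have s: "(LINT x|M. u x * (sin (\<phi> x) * indicator A (X x))) = (LINT y|N. u' y * (sin (\<psi> y) * indicator A (Y y)))"
    using 0 2 iM[of "\<lambda>_. 1"] iN[of "\<lambda>_. 1"] iM[of "\<lambda>x. sin (\<phi> x)"] iN[of "\<lambda>x. sin (\<psi> x)"]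
    by (simp add: algebra_simps)
  have split: "of_real (a * b) * iexp p = of_real (a * (cos p * b)) + \<i> * of_real (a * (sin p * b))" for a b p :: real
    unfolding iexp_eq_Complex by (simp add: complex_eq_iff)
  show ?thesis
    unfolding split using c s iM[of "\<lambda>x. cos (\<phi> x)"] iN[of "\<lambda>x. cos (\<psi> x)"]
      iM[of "\<lambda>x. sin (\<phi> x)"] iN[of "\<lambda>x. sin (\<psi> x)"]
    by (subst (1 2) Bochner_Integration.integral_add) (auto simp del: of_real_mult simp add: integral_complex_of_real)
qed

lemma integral_indicators_iexp_eq:
  fixes X :: "'i \<Rightarrow> 'a \<Rightarrow> real" and Y :: "'i \<Rightarrow> 'b \<Rightarrow> real"
  assumes M: "prob_space M" and N: "prob_space N"
    and X: "\<And>i. i \<in> I \<Longrightarrow> X i \<in> borel_measurable M"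
    and Y: "\<And>i. i \<in> I \<Longrightarrow> Y i \<in> borel_measurable N"
    and eq: "\<And>J c. finite J \<Longrightarrow> J \<subseteq> I \<Longrightarrow>
      (CLINT x|M. iexp (\<Sum>i\<in>J. c i * X i x)) = (CLINT y|N. iexp (\<Sum>i\<in>J. c i * Y i y))"
    and "finite J" "J \<subseteq> I" "\<And>j. j \<in> J \<Longrightarrow> A j \<in> sets borel"
    and "finite L" "L \<subseteq> I" "J \<inter> L = {}"
  shows "(CLINT x|M. of_real (\<Prod>j\<in>J. indicator (A j) (X j x)) * iexp (\<Sum>i\<in>L. c i * X i x)) =
    (CLINT y|N. of_real (\<Prod>j\<in>J. indicator (A j) (Y j y)) * iexp (\<Sum>i\<in>L. c i * Y i y))"
  using assms(6-)
proof (induction J arbitrary: L c rule: finite_induct)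
  case empty
  then show ?case using eq[of L c] by simp
next
  case (insert j J)
  have [measurable]: "X i \<in> borel_measurable M" "Y i \<in> borel_measurable N" if "i \<in> insert j (J \<union> L)" for i
    using X Y that insert.prems by auto
  have [measurable]: "A i \<in> sets borel" if "i \<in> insert j J" for i using insert.prems that by auto
  have m: "(\<lambda>x. \<Prod>j\<in>J. indicator (A j) (X j x) :: real) \<in> borel_measurable M"
    "(\<lambda>x. \<Prod>j\<in>J. indicator (A j) (Y j x) :: real) \<in> borel_measurable N" 
    "(\<lambda>x. \<Sum>i\<in>L. c i * X i x) \<in> borel_measurable M" "(\<lambda>x. \<Sum>i\<in>L. c i * Y i x) \<in> borel_measurable N"
    by (intro borel_measurable_prod borel_measurable_sum; measurable)+
  have "(CLINT x|M. of_real ((\<Prod>j\<in>J. indicator (A j) (X j x)) * indicator (A j) (X j x)) * iexp (\<Sum>i\<in>L. c i * X i x)) =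
    (CLINT y|N. of_real ((\<Prod>j\<in>J. indicator (A j) (Y j y)) * indicator (A j) (Y j y)) * iexp (\<Sum>i\<in>L. c i * Y i y))"
  proof (rule integral_weighted_iexp_eq[OF M N])
    fix s t
    \<comment> \<open>The induction hypothesis is applied with \<open>j\<close> still in the
      exponent, at every frequency \<open>s\<close>; this is why \<open>L\<close> and
      \<open>c\<close> vary in the induction.\<close>
    have *: "s * Z j + t * (\<Sum>i\<in>L. c i * Z i) = (\<Sum>i\<in>insert j L. (if i = j then s else t * c i) * Z i)" for Z :: "'i \<Rightarrow> real"
    proof -
      have "j \<notin> L" using insert by auto
      then have "(\<Sum>i\<in>L. (if i = j then s else t * c i) * Z i) = (\<Sum>i\<in>L. t * (c i * Z i))"
        by (intro sum.cong) auto
      then show ?thesis using insert \<open>j \<notin> L\<close> by (simp add: sum_distrib_left)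
    qed
    show "(CLINT x|M. of_real (\<Prod>j\<in>J. indicator (A j) (X j x)) * iexp (s * X j x + t * (\<Sum>i\<in>L. c i * X i x))) =
      (CLINT y|N. of_real (\<Prod>j\<in>J. indicator (A j) (Y j y)) * iexp (s * Y j y + t * (\<Sum>i\<in>L. c i * Y i y)))"
      unfolding *[of "\<lambda>i. X i x" for x] *[of "\<lambda>i. Y i x" for x] by (rule insert.IH) (use insert in auto)
  qed (use m in \<open>auto intro!: prod_le_1 prod_nonneg simp: indicator_le_1\<close>)
  then show ?case using insert by (simp add: mult_ac)
qed

text \<open>Once all variables are traded for indicators the exponent is empty and the identity is
  about probabilities of boxes in finitely many coordinates. Such boxes determine a finite measure
  on the product sigma-algebra, also for infinite \<open>I\<close>.\<close>

theorem Cramer_Wold: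
  fixes X :: "'i \<Rightarrow> 'a \<Rightarrow> real" and Y :: "'i \<Rightarrow> 'b \<Rightarrow> real"
  assumes M: "prob_space M" and N: "prob_space N"
    and X [measurable]: "\<And>i. i \<in> I \<Longrightarrow> X i \<in> borel_measurable M"
    and Y [measurable]: "\<And>i. i \<in> I \<Longrightarrow> Y i \<in> borel_measurable N"
    and eq: "\<And>J c. finite J \<Longrightarrow> J \<subseteq> I \<Longrightarrow>
      (CLINT x|M. iexp (\<Sum>i\<in>J. c i * X i x)) = (CLINT y|N. iexp (\<Sum>i\<in>J. c i * Y i y))"
  shows "distr M (PiM I (\<lambda>_. borel)) (\<lambda>x. \<lambda>i\<in>I. X i x) = distr N (PiM I (\<lambda>_. borel)) (\<lambda>y. \<lambda>i\<in>I. Y i y)"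
    (is "?D = ?E")
proof (rule measure_eqI_PiM_infinite[where I = I and M = "\<lambda>_. borel"])
  interpret M: prob_space M by fact
  interpret N: prob_space N by fact
  show "finite_measure ?D"
    using M.prob_space_distr[of "\<lambda>x. \<lambda>i\<in>I. X i x" "PiM I (\<lambda>_. borel)"] by (simp add: prob_space_def)
  fix A J assume J: "finite J" "J \<subseteq> I" and A: "\<And>i. i \<in> J \<Longrightarrow> A i \<in> sets (borel :: real measure)"
  have [measurable]: "prod_emb I (\<lambda>_. borel) J (Pi\<^sub>E J A) \<in> sets (PiM I (\<lambda>_. borel))"
    using J A by (intro sets_PiM_I) auto
  have meas: "X i \<in> borel_measurable M" "Y i \<in> borel_measurable N" "A i \<in> sets borel" if "i \<in> J" for i
    using J that X Y A by auto
  have "emeasure ?D (prod_emb I (\<lambda>_. borel) J (Pi\<^sub>E J A)) = emeasure M {x \<in> space M. \<forall>j\<in>J. X j x \<in> A j}"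
    using J by (subst emeasure_distr; (measurable; fail)?)
      (auto simp: prod_emb_def space_PiM Int_absorb1 subset_eq PiE_iff intro!: arg_cong[where f = "emeasure M"])
  also have "\<dots> = ennreal (LINT x|M. (\<Prod>j\<in>J. indicator (A j) (X j x)))"
  proof -
    have "(LINT x|M. (\<Prod>j\<in>J. indicator (A j) (X j x)) :: real) = (LINT x|M. indicator {x \<in> space M. \<forall>j\<in>J. X j x \<in> A j} x)"
      using J by (intro Bochner_Integration.integral_cong) (auto simp: indicator_def prod_zero_iff)
    also have "\<dots> = measure M {x \<in> space M. \<forall>j\<in>J. X j x \<in> A j}" 
      by (auto simp: Int_def intro!: arg_cong[where f = "measure M"])
    finally show ?thesis by (simp add: M.emeasure_eq_measure)
  qed
  also have "(LINT x|M. (\<Prod>j\<in>J. indicator (A j) (X j x))) = (LINT x|N. (\<Prod>j\<in>J. indicator (A j) (Y j x)) :: real)"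
  proof -
    have "(CLINT x|M. of_real (\<Prod>j\<in>J. indicator (A j) (X j x)) * iexp (\<Sum>i\<in>{}. 0 * X i x)) =
      (CLINT x|N. of_real (\<Prod>j\<in>J. indicator (A j) (Y j x)) * iexp (\<Sum>i\<in>{}. 0 * Y i x))"
      by (rule integral_indicators_iexp_eq[OF M N X Y eq]) (use J A in auto)
    then show ?thesis by (simp only: sum.empty of_real_0 mult_zero_right exp_zero mult_1_right
        integral_complex_of_real of_real_eq_iff)
  qed
  also have "ennreal (LINT x|N. (\<Prod>j\<in>J. indicator (A j) (Y j x))) = emeasure N {x \<in> space N. \<forall>j\<in>J. Y j x \<in> A j}"
  proof -
    have "(LINT x|N. (\<Prod>j\<in>J. indicator (A j) (Y j x)) :: real) = (LINT x|N. indicator {x \<in> space N. \<forall>j\<in>J. Y j x \<in> A j} x)"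
      using J by (intro Bochner_Integration.integral_cong) (auto simp: indicator_def prod_zero_iff)
    also have "\<dots> = measure N {x \<in> space N. \<forall>j\<in>J. Y j x \<in> A j}" 
      by (auto simp: Int_def intro!: arg_cong[where f = "measure N"])
    finally show ?thesis by (simp add: N.emeasure_eq_measure)
  qed
  also have "\<dots> = emeasure ?E (prod_emb I (\<lambda>_. borel) J (Pi\<^sub>E J A))"
    using J by (subst emeasure_distr; (measurable; fail)?)
      (auto simp: prod_emb_def space_PiM Int_absorb1 subset_eq PiE_iff intro!: arg_cong[where f = "emeasure N"])
  finally show "emeasure ?D (prod_emb I (\<lambda>_. borel) J (Pi\<^sub>E J A)) = emeasure ?E (prod_emb I (\<lambda>_. borel) J (Pi\<^sub>E J A))" .
qed simp_all

section \<open>Independence and normal laws in terms of characteristic functions\<close>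

lemma (in prob_space) indep_varsI_iexp:
  fixes X :: "'i \<Rightarrow> 'a \<Rightarrow> real"
  assumes I: "finite I" and X [measurable]: "\<And>i. i \<in> I \<Longrightarrow> X i \<in> borel_measurable M"
    and eq: "\<And>c. expectation (\<lambda>x. iexp (\<Sum>i\<in>I. c i * X i x)) = (\<Prod>i\<in>I. expectation (\<lambda>x. iexp (c i * X i x)))"
  shows "indep_vars (\<lambda>_. borel) X I"
proof (cases "I = {}")
  case True
  then show ?thesis by (simp add: indep_vars_def indep_sets_def)
next
  case False
  \<comment> \<open>\<open>X i\<close> is known to be measurable only for \<open>i\<close> in
    \<open>I\<close>, whereas the product locale wants a probability measure at every index; the
    point mass at 0 fills the gap.\<close>
  define D where "D i = (if i \<in> I then distr M borel (X i) else distr M borel (\<lambda>_. 0))" for i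
  have D: "prob_space (D i)" and sD [simp, measurable_cong]: "sets (D i) = sets borel" for i
    by (auto simp: D_def intro!: prob_space_distr prob_space_return)
  interpret D: prob_space "D i" for i by (rule D)
  interpret P: product_prob_space D I by unfold_locales
  interpret F: finite_product_prob_space D I by unfold_locales (rule I)
  have sP: "sets (PiM I D) = sets (PiM I (\<lambda>_. borel))" by (intro sets_PiM_cong) auto
  have "distr M (PiM I (\<lambda>_. borel)) (\<lambda>x. \<lambda>i\<in>I. X i x) = distr (PiM I D) (PiM I (\<lambda>_. borel)) (\<lambda>y. \<lambda>i\<in>I. y i)"
  proof (rule Cramer_Wold)
    show "prob_space M" by unfold_locales
    show "prob_space (PiM I D)" by unfold_locales
    show "(\<lambda>y. y i) \<in> borel_measurable (PiM I D)" if "i \<in> I" for i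
      using measurable_component_singleton[of i I D] that measurable_cong_sets[OF refl sD] by blast
    fix J c assume J: "finite J" "J \<subseteq> I"
    \<comment> \<open>The factorisation is given for combinations over all of \<open>I\<close>;
      padding with zeros brings a subfamily \<open>J\<close> into that form.\<close>
    define c' where "c' i = (if i \<in> J then c i else 0 :: real)" for i
    have c': "(\<Sum>i\<in>J. c i * f i) = (\<Sum>i\<in>I. c' i * f i)" for f :: "'i \<Rightarrow> real"
      by (rule sum.mono_neutral_cong_left) (use J I in \<open>auto simp: c'_def\<close>)
    have e: "iexp (\<Sum>i\<in>I. c' i * f i) = (\<Prod>i\<in>I. iexp (c' i * f i))" for f :: "'i \<Rightarrow> real"
      using I by (simp add: exp_sum sum_distrib_left)
    have "(CLINT y|PiM I D. iexp (\<Sum>i\<in>J. c i * y i)) = (\<Prod>i\<in>I. CLINT x|D i. iexp (c' i * x))"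
      unfolding c' e
    proof (rule P.product_integral_prod[OF I])
      fix i assume "i \<in> I"
      show "complex_integrable (D i) (\<lambda>x. iexp (c' i * x))"
        by (rule D.integrable_iexp) auto
    qed
    also have "\<dots> = (\<Prod>i\<in>I. expectation (\<lambda>x. iexp (c' i * X i x)))"
      by (intro prod.cong) (auto simp: D_def integral_distr)
    finally show "expectation (\<lambda>x. iexp (\<Sum>i\<in>J. c i * X i x)) = (CLINT y|PiM I D. iexp (\<Sum>i\<in>J. c i * y i))"
      unfolding c' eq by simp
  qed simp
  also have "\<dots> = PiM I D"
    by (subst distr_cong[OF refl sP[symmetric], where g = "\<lambda>x. x"])
      (auto simp: space_PiM PiE_def extensional_restrict)
  also have "\<dots> = PiM I (\<lambda>i. distr M borel (X i))"
    by (intro PiM_cong) (auto simp: D_def)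
  finally show ?thesis
    using indep_vars_iff_distr_eq_PiM'[OF False X] by simp
qed

lemma (in prob_space) expectation_iexp_sum_indep:
  fixes X :: "'i \<Rightarrow> 'a \<Rightarrow> real"
  assumes "indep_vars (\<lambda>_. borel) X I"
  shows "expectation (\<lambda>x. iexp (\<Sum>i\<in>I. X i x)) = (\<Prod>i\<in>I. expectation (\<lambda>x. iexp (X i x)))"
proof -
  have X [measurable]: "random_variable borel (X i)" if "i \<in> I" for i
    using assms that by (simp add: indep_vars_def)
  have "(\<lambda>x. \<Sum>i\<in>I. X i x) \<in> borel_measurable M"
    by (intro borel_measurable_sum X)
  then have "expectation (\<lambda>x. iexp (\<Sum>i\<in>I. X i x)) = char (distr M borel (\<lambda>\<omega>. \<Sum>i\<in>I. X i \<omega>)) 1"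
    by (simp add: char_def integral_distr)
  also have "\<dots> = (\<Prod>i\<in>I. char (distr M borel (X i)) 1)"
    by (rule char_distr_sum[OF assms])
  also have "\<dots> = (\<Prod>i\<in>I. expectation (\<lambda>x. iexp (X i x)))"
    by (intro prod.cong) (auto simp: char_def integral_distr)
  finally show ?thesis .
qed

lemma (in prob_space) expectation_iexp_std_normal:
  assumes "distributed M lborel X std_normal_density"
  shows "expectation (\<lambda>x. iexp (t * X x)) = exp (- t\<^sup>2 / 2)"
proof -
  have [measurable]: "X \<in> borel_measurable M" using distributed_measurable[OF assms] by simp
  have "expectation (\<lambda>x. iexp (t * X x)) = (CLINT x|distr M lborel X. iexp (t * x))"
    by (simp add: integral_distr)
  also have "distr M lborel X = std_normal_distribution"
    using assms by (simp add: distributed_def)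
  also have "(CLINT x|std_normal_distribution. iexp (t * x)) = char std_normal_distribution t"
    by (simp add: char_def)
  finally show ?thesis by (simp add: char_std_normal_distribution)
qed

lemma (in prob_space) normal_square_integrable:
  assumes X: "distributed M lborel X (normal_density \<mu> \<sigma>)" and \<sigma>: "\<sigma> > 0"
  shows "integrable M X" "integrable M (\<lambda>x. (X x)\<^sup>2)"
proof -
  have [measurable]: "X \<in> borel_measurable M" using distributed_measurable[OF X] by simp
  have i: "integrable M (\<lambda>x. (X x - \<mu>) ^ k)" for k
    using integrable_normal_moment[OF \<sigma>, of \<mu> k] distributed_integrable[OF X, of "\<lambda>x. (x - \<mu>) ^ k"] by simp
  have "integrable M (\<lambda>x. (X x - \<mu>) ^ 1 + \<mu>)" by (intro Bochner_Integration.integrable_add i) simp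
  then show "integrable M X" by simp
  have "integrable M (\<lambda>x. (X x - \<mu>) ^ 2 + (2 * \<mu> * (X x - \<mu>) ^ 1 + \<mu>\<^sup>2))"
    by (intro Bochner_Integration.integrable_add i integrable_mult_right) simp
  then show "integrable M (\<lambda>x. (X x)\<^sup>2)" by (simp add: power2_eq_square algebra_simps)
qed

lemma (in prob_space) gaussian_rv_square_integrable:
  assumes "gaussian_rv X"
  shows "integrable M X" "integrable M (\<lambda>x. (X x)\<^sup>2)"
proof -
  have [measurable]: "X \<in> borel_measurable M" using assms by (simp add: gaussian_rv_def)
  consider \<mu> \<sigma> where "\<sigma> > 0" "distributed M lborel X (normal_density \<mu> \<sigma>)" | \<mu> where "AE x in M. X x = \<mu>"
    using assms unfolding gaussian_rv_def by blast
  then have "integrable M X \<and> integrable M (\<lambda>x. (X x)\<^sup>2)"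
  proof cases
    case 2
    then have "AE x in M. X x = \<mu>" "AE x in M. (X x)\<^sup>2 = \<mu>\<^sup>2" by auto
    then show ?thesis
      using integrable_cong_AE[of X M "\<lambda>_. \<mu>"] integrable_cong_AE[of "\<lambda>x. (X x)\<^sup>2" M "\<lambda>_. \<mu>\<^sup>2"] by simp
  qed (use normal_square_integrable in blast)
  then show "integrable M X" "integrable M (\<lambda>x. (X x)\<^sup>2)" by auto
qed

text \<open>A point mass obeys the same formula with variance 0, so no later argument has to
  distinguish the two disjuncts of \<open>gaussian_rv\<close>.\<close>

lemma (in prob_space) expectation_iexp_gaussian:
  assumes "gaussian_rv X"
  shows "expectation (\<lambda>x. iexp (X x)) = iexp (expectation X) * exp (- variance X / 2)"
proof -
  have [measurable]: "X \<in> borel_measurable M" using assms by (simp add: gaussian_rv_def)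
  consider \<mu> \<sigma> where "\<sigma> > 0" "distributed M lborel X (normal_density \<mu> \<sigma>)" | \<mu> where "AE x in M. X x = \<mu>"
    using assms unfolding gaussian_rv_def by blast
  then show ?thesis
  proof cases
    case 1
    have "distributed M lborel (\<lambda>x. (X x - \<mu>) / \<sigma>) std_normal_density"
      using 1 normal_standard_normal_convert by blast
    from expectation_iexp_std_normal[OF this, of \<sigma>]
    have "expectation (\<lambda>x. iexp (X x - \<mu>)) = exp (- \<sigma>\<^sup>2 / 2)" using 1 by simp
    then have "iexp \<mu> * expectation (\<lambda>x. iexp (X x - \<mu>)) = iexp \<mu> * exp (- \<sigma>\<^sup>2 / 2)" by simp
    also have "iexp \<mu> * expectation (\<lambda>x. iexp (X x - \<mu>)) = expectation (\<lambda>x. iexp \<mu> * iexp (X x - \<mu>))"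
      by simp
    also have "\<dots> = expectation (\<lambda>x. iexp (X x))"
      by (simp add: exp_add[symmetric] algebra_simps)
    finally show ?thesis
      using normal_distributed_expectation[OF 1] normal_distributed_variance[OF 1] by simp
  next
    case 2
    have "expectation (\<lambda>x. iexp (X x)) = expectation (\<lambda>_. iexp \<mu>)"
      using 2 by (intro integral_cong_AE) auto
    moreover have e: "expectation X = expectation (\<lambda>_. \<mu>)"
      using 2 by (intro integral_cong_AE) auto
    moreover have "variance X = expectation (\<lambda>_. 0)"
      unfolding e using 2 by (intro integral_cong_AE) (auto simp: prob_space)
    ultimately show ?thesis by (simp add: prob_space)
  qed
qed

lemma (in prob_space) distributed_normalI_iexp:
  fixes X :: "'a \<Rightarrow> real"
  assumes [measurable]: "X \<in> borel_measurable M" and \<sigma>: "\<sigma> > 0"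
    and eq: "\<And>t. expectation (\<lambda>x. iexp (t * X x)) = exp (- (t\<^sup>2 * \<sigma>\<^sup>2) / 2)"
  shows "distributed M lborel X (normal_density 0 \<sigma>)"
proof -
  have "distr M borel (\<lambda>x. (X x - 0) / \<sigma>) = std_normal_distribution"
  proof (rule Levy_uniqueness)
    show "char (distr M borel (\<lambda>x. (X x - 0) / \<sigma>)) = char std_normal_distribution"
    proof
      fix t
      have "char (distr M borel (\<lambda>x. (X x - 0) / \<sigma>)) t = expectation (\<lambda>x. iexp (t / \<sigma> * X x))"
        by (simp add: char_def integral_distr)
      also have "\<dots> = exp (- ((t / \<sigma>)\<^sup>2 * \<sigma>\<^sup>2) / 2)" by (rule eq)
      also have "(t / \<sigma>)\<^sup>2 * \<sigma>\<^sup>2 = t\<^sup>2" using \<sigma> by (simp add: power_divide)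
      finally show "char (distr M borel (\<lambda>x. (X x - 0) / \<sigma>)) t = char std_normal_distribution t"
        by (simp add: char_std_normal_distribution)
    qed
  qed (auto intro: real_dist_normal_dist)
  moreover have "distr M lborel (\<lambda>x. (X x - 0) / \<sigma>) = distr M borel (\<lambda>x. (X x - 0) / \<sigma>)"
    by (rule distr_cong) auto
  ultimately have "distributed M lborel (\<lambda>x. (X x - 0) / \<sigma>) std_normal_density"
    by (simp add: distributed_def)
  then show ?thesis using normal_standard_normal_convert[OF \<sigma>, of X 0] by simp
qed

section \<open>Schauder expansion of the Brownian bridge kernel\<close>

definition tent :: "real \<Rightarrow> real" where
  "tent x = max 0 (1 - \<bar>2 * x - 1\<bar>)"

definition bridge_cov :: "real \<Rightarrow> real \<Rightarrow> real" where
  "bridge_cov s t = min s t - s * t"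

lemma tent_nonneg: "0 \<le> tent x" and tent_le_1: "tent x \<le> 1"
  by (auto simp: tent_def)

lemma tent_minus_int: "tent (x - of_int k) = (if k = \<lfloor>x\<rfloor> then tent (frac x) else 0)"
proof (cases "k = \<lfloor>x\<rfloor>")
  case False
  then have "k \<le> \<lfloor>x\<rfloor> - 1 \<or> \<lfloor>x\<rfloor> + 1 \<le> k" by linarith
  then have "x - of_int k \<ge> 1 \<or> x - of_int k \<le> 0" by linarith
  with False show ?thesis by (auto simp: tent_def)
qed (simp add: frac_def)

text \<open>The Brownian bridge kernel is self-similar under the doubling map: on each dyadic half interval
  it is a rank one tent kernel plus a rescaled copy of itself. Hence \<open>local_cov (2^N * s) (2^N * t) / 2^N\<close>
  is exactly what the first \<open>N\<close> levels of the Schauder expansion leave over.\<close>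

definition local_cov :: "real \<Rightarrow> real \<Rightarrow> real" where
  "local_cov x y = (if \<lfloor>x\<rfloor> = \<lfloor>y\<rfloor> then bridge_cov (frac x) (frac y) else 0)"

lemma floor_double: "\<lfloor>2 * x\<rfloor> = 2 * \<lfloor>x\<rfloor> + (if frac x < 1 / 2 then 0 else 1)" for x :: real
  unfolding frac_def by (auto intro!: floor_unique; linarith)

lemma frac_double: "frac (2 * x) = 2 * frac x - (if frac x < 1 / 2 then 0 else 1)" for x :: real
  using floor_double[of x] by (simp add: frac_def)

lemma local_cov_self_similar:
  "local_cov x y = (if \<lfloor>x\<rfloor> = \<lfloor>y\<rfloor> then tent (frac x) * tent (frac y) / 4 else 0) + local_cov (2 * x) (2 * y) / 2"
proof (cases "\<lfloor>x\<rfloor> = \<lfloor>y\<rfloor>")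
  case True
  define a b where "a = frac x" and "b = frac y"
  have ab: "0 \<le> a" "a < 1" "0 \<le> b" "b < 1" by (auto simp: a_def b_def frac_ge_0 frac_lt_1)
  \<comment> \<open>In different halves, say \<open>a < 1 / 2 \<le> b\<close>, the rescaled copy
    vanishes and the tents alone give \<open>(2 * a) * (2 * (1 - b)) / 4 = a * (1 - b)\<close>,
    which is the kernel. In the same half the copy supplies the difference.\<close>
  show ?thesis
    unfolding local_cov_def floor_double frac_double True a_def[symmetric] b_def[symmetric]
    using ab by (auto simp: bridge_cov_def tent_def min_def max_def abs_if field_simps)
next
  case False
  then have "\<lfloor>2 * x\<rfloor> \<noteq> \<lfloor>2 * y\<rfloor>" unfolding floor_double by auto
  with False show ?thesis by (simp add: local_cov_def)
qed

text \<open>A tent vanishes outside (0, 1), so only the cell that contains \<open>2^n * s\<close>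
  contributes. The bounds on \<open>s\<close> put the index of that cell into the range of
  summation.\<close>

lemma sum_tent_product:
  assumes "0 \<le> s" "s < 1"
  shows "(\<Sum>k<2^n. tent (2^n * s - real k) * tent (2^n * t - real k)) =
    (if \<lfloor>2^n * s\<rfloor> = \<lfloor>2^n * t\<rfloor> then tent (frac (2^n * s)) * tent (frac (2^n * t)) else 0)"
proof -
  define p where "p = nat \<lfloor>2^n * s\<rfloor>"
  have "\<lfloor>2^n * s\<rfloor> < 2^n" using assms by (simp add: floor_less_iff)
  then have p: "p < 2^n" "\<lfloor>2^n * s\<rfloor> = int p" using assms by (auto simp: p_def nat_less_iff)
  have 1: "tent (2^n * x - real k) = (if int k = \<lfloor>2^n * x\<rfloor> then tent (frac (2^n * x)) else 0)" for x k
    using tent_minus_int[of "2^n * x" "int k"] by simp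
  have "(\<Sum>k<2^n. tent (2^n * s - real k) * tent (2^n * t - real k)) =
    (\<Sum>k<2^n. if k = p then tent (frac (2^n * s)) * (if int k = \<lfloor>2^n * t\<rfloor> then tent (frac (2^n * t)) else 0) else 0)"
    unfolding 1 p by (intro sum.cong) auto
  then show ?thesis using p by simp
qed

lemma sum_tent_le_1: "(\<Sum>k<K. tent (x - real k)) \<le> 1"
proof -
  have "(\<Sum>k<K. tent (x - real k)) = (\<Sum>k<K. if k = nat \<lfloor>x\<rfloor> then (if \<lfloor>x\<rfloor> \<ge> 0 then tent (frac x) else 0) else 0)"
  proof (intro sum.cong refl)
    fix k show "tent (x - real k) = (if k = nat \<lfloor>x\<rfloor> then (if \<lfloor>x\<rfloor> \<ge> 0 then tent (frac x) else 0) else 0)"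
      using tent_minus_int[of x "int k"] by (cases "0 \<le> \<lfloor>x\<rfloor>") (auto simp del: zero_le_floor)
  qed
  then show ?thesis using tent_le_1 by simp
qed

text \<open>Primitives of the Haar functions normalised in L2: \<open>tent\<close> is twice the
  primitive of the basic Haar function, and compressing time by \<open>2^n\<close> while scaling
  height by \<open>sqrt (2^n)\<close> leaves the factor \<open>1 / (2 * sqrt (2^n))\<close>. The
  primitive \<open>t\<close> of the constant function is left out; this removes \<open>s * t\<close>
  from \<open>min s t\<close> and makes the series a bridge.\<close>

definition schauder :: "nat \<times> nat \<Rightarrow> real \<Rightarrow> real" where
  "schauder = (\<lambda>(n, k) t. tent (2^n * t - real k) / (2 * sqrt (2^n)))"

lemma schauder_0 [simp]: "schauder p 0 = 0"
  by (auto simp: schauder_def tent_def split: prod.split)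

lemma continuous_on_schauder: "continuous_on UNIV (schauder p)"
  unfolding schauder_def tent_def by (auto split: prod.split intro!: continuous_intros)

lemma sum_schauder_product:
  assumes "0 \<le> s" "s < 1" "0 \<le> t" "t < 1"
  shows "(\<Sum>n<N. \<Sum>k<2^n. schauder (n, k) s * schauder (n, k) t) =
    bridge_cov s t - local_cov (2^N * s) (2^N * t) / 2^N"
proof (induction N)
  case 0
  have "\<lfloor>s\<rfloor> = 0" "\<lfloor>t\<rfloor> = 0" using assms by (auto intro: floor_unique)
  then show ?case by (simp add: local_cov_def frac_def)
next
  case (Suc N)
  have "(\<Sum>k<2^N. schauder (N, k) s * schauder (N, k) t) =
      (\<Sum>k<2^N. tent (2^N * s - real k) * tent (2^N * t - real k)) / (4 * 2^N)"
    by (simp add: schauder_def sum_divide_distrib)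
  also have "\<dots> = local_cov (2^N * s) (2^N * t) / 2^N - local_cov (2^Suc N * s) (2^Suc N * t) / 2^Suc N"
    unfolding sum_tent_product[OF assms(1,2)] local_cov_self_similar[of "2^N * s" "2^N * t"]
    by (simp add: field_simps)
  finally show ?case using Suc by simp
qed

lemma sum_schauder_product_tendsto:
  assumes "0 \<le> s" "s < 1" "0 \<le> t" "t < 1"
  shows "(\<lambda>N. \<Sum>n<N. \<Sum>k<2^n. schauder (n, k) s * schauder (n, k) t) \<longlonglongrightarrow> bridge_cov s t"
proof -
  have bd: "\<bar>local_cov x y\<bar> \<le> 1" for x y
  proof -
    have *: "a * b \<le> min a b" "0 \<le> a * b" "min a b \<le> 1" if "0 \<le> a" "a < 1" "0 \<le> b" "b < 1" for a b :: real
      using that mult_mono[of a a b 1] mult_mono[of a 1 b b] by auto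
    from *[OF frac_ge_0 frac_lt_1 frac_ge_0 frac_lt_1, of x y] show ?thesis
      unfolding local_cov_def bridge_cov_def by (simp, linarith)
  qed
  have "(\<lambda>N. local_cov (2^N * s) (2^N * t) / 2^N) \<longlonglongrightarrow> 0"
  proof (rule tendsto_0_le[where K = 1])
    show "(\<lambda>N. (1 / 2) ^ N :: real) \<longlonglongrightarrow> 0" by (rule LIMSEQ_power_zero) simp
    show "\<forall>\<^sub>F N in sequentially. norm (local_cov (2^N * s) (2^N * t) / 2^N) \<le> norm ((1 / 2) ^ N :: real) * 1"
      using bd by (intro always_eventually allI) (simp add: power_one_over divide_right_mono)
  qed
  from tendsto_diff[OF tendsto_const[of "bridge_cov s t"] this] show ?thesis
    unfolding sum_schauder_product[OF assms] by simp
qed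

text \<open>The tents of one level do not overlap, so the level is bounded by its largest
  coefficient times the height of a single tent, without a factor \<open>2^n\<close>.\<close>

lemma sum_schauder_bound:
  assumes "\<And>k. k < 2^n \<Longrightarrow> \<bar>x k\<bar> \<le> C"
  shows "\<bar>\<Sum>k<2^n. x k * schauder (n, k) t\<bar> \<le> C / (2 * sqrt (2^n))"
proof -
  have C: "0 \<le> C" using assms[of 0] by simp
  have "\<bar>\<Sum>k<2^n. x k * schauder (n, k) t\<bar> \<le> (\<Sum>k<2^n. C * schauder (n, k) t)"
    using assms by (intro order_trans[OF sum_abs] sum_mono)
      (auto simp: abs_mult schauder_def tent_nonneg intro!: mult_right_mono divide_right_mono)
  also have "\<dots> = C / (2 * sqrt (2^n)) * (\<Sum>k<2^n. tent (2^n * t - real k))"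
    by (simp add: schauder_def sum_distrib_left)
  also have "\<dots> \<le> C / (2 * sqrt (2^n)) * 1"
    using C by (intro mult_left_mono sum_tent_le_1[of "2^n * t" "2^n"]) auto
  finally show ?thesis by simp
qed

section \<open>Existence of Brownian motion\<close>

lemma prod_exp_neg_half:
  "finite I \<Longrightarrow> (\<Prod>p\<in>I. complex_of_real (exp (- f p / 2))) = exp (- (\<Sum>p\<in>I. f p) / 2)"
  by (induction rule: finite_induct) (simp_all add: add_divide_distrib exp_add[symmetric] flip: of_real_mult)

locale white_noise = prob_space +
  fixes \<xi> :: "nat \<times> nat \<Rightarrow> 'a \<Rightarrow> real"
  assumes indep: "indep_vars (\<lambda>_. borel) \<xi> UNIV"
    and normal: "\<And>p. distributed M lborel (\<xi> p) std_normal_density"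
begin

lemma \<xi>_measurable [measurable]: "\<xi> p \<in> borel_measurable M"
  using distributed_measurable[OF normal] by simp

lemma expectation_iexp_noise_sum:
  assumes "finite I"
  shows "expectation (\<lambda>\<omega>. iexp (\<Sum>p\<in>I. a p * \<xi> p \<omega>)) = exp (- (\<Sum>p\<in>I. (a p)\<^sup>2) / 2)"
proof -
  have "indep_vars (\<lambda>_. borel) (\<lambda>p \<omega>. a p * \<xi> p \<omega>) I"
    by (rule indep_vars_compose2[OF indep_vars_subset[OF indep]]) auto
  from expectation_iexp_sum_indep[OF this]
  have "expectation (\<lambda>\<omega>. iexp (\<Sum>p\<in>I. a p * \<xi> p \<omega>)) = (\<Prod>p\<in>I. complex_of_real (exp (- (a p)\<^sup>2 / 2)))"
    by (simp only: expectation_iexp_std_normal[OF normal])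
  also have "\<dots> = exp (- (\<Sum>p\<in>I. (a p)\<^sup>2) / 2)"
    using assms by (rule prod_exp_neg_half)
  finally show ?thesis .
qed

text \<open>Markov's inequality for the fourth moment, which is 3. The second moment would be too
  weak: uniform convergence asks for coefficients of growth \<open>r^n\<close> with
  \<open>r < sqrt 2\<close>, and then \<open>2^n / r^(2 * n)\<close> is not summable.\<close>

lemma noise_tail:
  assumes "0 < K"
  shows "prob {\<omega>\<in>space M. K < \<bar>\<xi> p \<omega>\<bar>} \<le> 3 / K ^ 4"
proof -
  have i: "integrable M (\<lambda>\<omega>. \<xi> p \<omega> ^ 4)"
    using integrable_std_normal_moment[of 4] distributed_integrable[OF normal, of "\<lambda>x. x ^ 4" p] by simp
  have e: "expectation (\<lambda>\<omega>. \<xi> p \<omega> ^ 4) = 3"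
    using integral_std_normal_moment_even[of 2] distributed_integral[OF normal, of "\<lambda>x. x ^ 4" p]
    by (simp add: fact_numeral)
  have "prob {\<omega>\<in>space M. K < \<bar>\<xi> p \<omega>\<bar>} \<le> prob {\<omega>\<in>space M. K ^ 4 \<le> \<xi> p \<omega> ^ 4}"
  proof (rule finite_measure_mono)
    show "{\<omega>\<in>space M. K < \<bar>\<xi> p \<omega>\<bar>} \<subseteq> {\<omega>\<in>space M. K ^ 4 \<le> \<xi> p \<omega> ^ 4}"
    proof safe
      fix \<omega> assume "K < \<bar>\<xi> p \<omega>\<bar>"
      then have "K ^ 4 \<le> \<bar>\<xi> p \<omega>\<bar> ^ 4" using assms by (intro power_mono) auto
      then show "K ^ 4 \<le> \<xi> p \<omega> ^ 4" by (simp add: power_even_abs)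
    qed
  qed measurable
  also have "\<dots> \<le> 3 / K ^ 4"
    using integral_Markov_inequality_measure[OF i, of "{}" "K ^ 4"] assms
    by (simp add: e)
  finally show ?thesis .
qed

text \<open>The rate \<open>5/4\<close> is chosen such that \<open>5/4 < sqrt 2\<close>, which makes the Schauder series converge
  uniformly, and \<open>(5/4)^4 > 2\<close>, which makes the fourth moment bound summable over the \<open>2^n\<close> variables
  of level \<open>n\<close>.\<close>

definition tame :: "'a \<Rightarrow> bool" where
  "tame \<omega> \<longleftrightarrow> (\<forall>\<^sub>F n in sequentially. \<forall>k<2^n. \<bar>\<xi> (n, k) \<omega>\<bar> \<le> (5 / 4) ^ n)"

lemma tame_measurable [measurable]: "Measurable.pred M tame"
  unfolding tame_def eventually_sequentially by measurable

lemma AE_tame: "AE \<omega> in M. tame \<omega>"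
proof -
  define A where "A n = {\<omega>\<in>space M. \<exists>k<2^n. (5 / 4) ^ n < \<bar>\<xi> (n, k) \<omega>\<bar>}" for n
  have A [measurable]: "A n \<in> sets M" for n unfolding A_def by measurable
  \<comment> \<open>The ratio \<open>512 / 625\<close> is \<open>2 / (5 / 4)^4\<close>: level
    \<open>n\<close> has \<open>2^n\<close> variables, each with tail bound
    \<open>3 / ((5 / 4)^n)^4\<close>.\<close>
  have "prob (A n) \<le> 3 * (512 / 625) ^ n" for n
  proof -
    have "A n = (\<Union>k<2^n. {\<omega>\<in>space M. (5 / 4) ^ n < \<bar>\<xi> (n, k) \<omega>\<bar>})"
      unfolding A_def by auto
    then have "prob (A n) \<le> (\<Sum>k<2^n. prob {\<omega>\<in>space M. (5 / 4) ^ n < \<bar>\<xi> (n, k) \<omega>\<bar>})"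
      by (auto intro!: finite_measure_subadditive_finite)
    also have "\<dots> \<le> (\<Sum>k<(2::nat)^n. 3 / ((5 / 4) ^ n) ^ 4)"
      by (intro sum_mono noise_tail) auto
    also have "((5 / 4) ^ n) ^ 4 = ((5 / 4) ^ 4 :: real) ^ n"
      by (simp only: power_mult[symmetric] mult.commute)
    also have "(\<Sum>k<(2::nat)^n. 3 / ((5 / 4) ^ 4) ^ n) = 3 * (2 / (5 / 4) ^ 4 :: real) ^ n"
      by (simp only: power_divide[of 2 "(5 / 4) ^ 4 :: real"]) simp
    finally show ?thesis by (simp add: power_divide[of 5 4 4])
  qed
  then have "summable (\<lambda>n. prob (A n))"
    by (intro summable_comparison_test[OF _ summable_mult[OF summable_geometric[of "512 / 625 :: real"], of 3]]) auto
  from borel_cantelli_AE1[OF A _ this] have "AE \<omega> in M. \<forall>\<^sub>F n in sequentially. \<omega> \<in> space M - A n"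
    by (simp add: emeasure_eq_measure)
  then show ?thesis
  proof eventually_elim
    case (elim \<omega>)
    then show ?case unfolding tame_def
      by eventually_elim (auto simp: A_def linorder_not_less[symmetric])
  qed
qed

section \<open>The Brownian bridge as a random Schauder series\<close>

definition bridge_level :: "nat \<Rightarrow> real \<Rightarrow> 'a \<Rightarrow> real" where
  "bridge_level n t \<omega> = (\<Sum>k<2^n. \<xi> (n, k) \<omega> * schauder (n, k) t)"

text \<open>Setting the process to 0 off the measurable event \<open>tame\<close> makes every path
  continuous, not just almost every one, as \<open>standard_brownian_motion\<close> demands.\<close>

definition bridge :: "real \<Rightarrow> 'a \<Rightarrow> real" where
  "bridge t \<omega> = (if tame \<omega> then (\<Sum>n. bridge_level n t \<omega>) else 0)"

lemma bridge_level_measurable [measurable]: "bridge_level n t \<in> borel_measurable M"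
  unfolding bridge_level_def by measurable

lemma bridge_measurable [measurable]: "bridge t \<in> borel_measurable M"
  unfolding bridge_def by measurable

lemma bridge_0 [simp]: "bridge 0 \<omega> = 0"
  by (simp add: bridge_def bridge_level_def)

lemma bridge_uniform_limit:
  assumes "tame \<omega>"
  shows "uniform_limit UNIV (\<lambda>N t. \<Sum>n<N. bridge_level n t \<omega>) (\<lambda>t. bridge t \<omega>) sequentially"
proof -
  have "uniform_limit UNIV (\<lambda>N t. \<Sum>n<N. bridge_level n t \<omega>) (\<lambda>t. \<Sum>n. bridge_level n t \<omega>) sequentially"
  \<comment> \<open>\<open>tame\<close> bounds only the late levels, from a level on that depends on
    \<open>\<omega>\<close>; hence the version of the test with an eventual bound.\<close>
  proof (rule Weierstrass_m_test_ev)
    have s: "(5 / 4) / sqrt 2 < (1 :: real)"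
      using real_less_rsqrt[of "5 / 4" 2] by (simp add: power2_eq_square)
    have e: "(5 / 4) ^ n / (2 * sqrt (2 ^ n)) = (1 / 2) * ((5 / 4) / sqrt 2) ^ n" for n
      by (simp add: real_sqrt_power power_divide)
    show "summable (\<lambda>n. (5 / 4) ^ n / (2 * sqrt (2 ^ n)) :: real)"
      unfolding e using s by (intro summable_mult summable_geometric) simp
    show "\<forall>\<^sub>F n in sequentially. \<forall>t\<in>UNIV. norm (bridge_level n t \<omega>) \<le> (5 / 4) ^ n / (2 * sqrt (2 ^ n))"
      using assms unfolding tame_def
      by eventually_elim (auto simp: bridge_level_def intro: sum_schauder_bound)
  qed
  with assms show ?thesis by (simp add: bridge_def[abs_def])
qed

lemma continuous_on_bridge: "continuous_on UNIV (\<lambda>t. bridge t \<omega>)"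
proof (cases "tame \<omega>")
  case True
  show ?thesis
  proof (rule uniform_limit_theorem[OF _ bridge_uniform_limit[OF True]])
    show "\<forall>\<^sub>F N in sequentially. continuous_on UNIV (\<lambda>t. \<Sum>n<N. bridge_level n t \<omega>)"
      unfolding bridge_level_def
      by (intro always_eventually allI continuous_intros continuous_on_schauder)
  qed simp
qed (simp add: bridge_def)

text \<open>The partial sums are finite combinations of the noise, so their characteristic functions
  are explicit. Their limit is computed twice: by dominated convergence along the almost surely
  convergent series, and by convergence of the kernels.\<close>

lemma expectation_iexp_bridge:
  fixes u a :: "'k \<Rightarrow> real"
  assumes K: "finite K" and u: "\<And>k. k \<in> K \<Longrightarrow> 0 \<le> u k \<and> u k < 1"
  shows "expectation (\<lambda>\<omega>. iexp (\<Sum>k\<in>K. a k * bridge (u k) \<omega>)) =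
    exp (- (\<Sum>k\<in>K. \<Sum>l\<in>K. a k * a l * bridge_cov (u k) (u l)) / 2)"
proof (rule LIMSEQ_unique)
  define S where "S N \<omega> = (\<Sum>k\<in>K. a k * (\<Sum>n<N. bridge_level n (u k) \<omega>))" for N \<omega>
  have [measurable]: "S N \<in> borel_measurable M" for N unfolding S_def by measurable
  show "(\<lambda>N. expectation (\<lambda>\<omega>. iexp (S N \<omega>))) \<longlonglongrightarrow> expectation (\<lambda>\<omega>. iexp (\<Sum>k\<in>K. a k * bridge (u k) \<omega>))"
  proof (rule integral_dominated_convergence[where w = "\<lambda>_. 1"])
    show "AE \<omega> in M. (\<lambda>N. iexp (S N \<omega>)) \<longlonglongrightarrow> iexp (\<Sum>k\<in>K. a k * bridge (u k) \<omega>)"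
      using AE_tame
    proof eventually_elim
      case (elim \<omega>)
      show ?case unfolding S_def
        by (intro tendsto_intros tendsto_uniform_limitI[OF bridge_uniform_limit[OF elim]]) simp
    qed
  qed auto
  define \<kappa> where "\<kappa> N s t = (\<Sum>n<N. \<Sum>k<2^n. schauder (n, k) s * schauder (n, k) t)" for N s t
  have "expectation (\<lambda>\<omega>. iexp (S N \<omega>)) = exp (- (\<Sum>k\<in>K. \<Sum>l\<in>K. a k * a l * \<kappa> N (u k) (u l)) / 2)" for N
  proof -
    define I where "I = (SIGMA n:{..<N}. {..<(2::nat)^n})"
    have I: "finite I" by (simp add: I_def)
    have sumI: "(\<Sum>n<N. \<Sum>k<2^n. f (n, k)) = (\<Sum>p\<in>I. f p)" for f :: "nat \<times> nat \<Rightarrow> real"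
      unfolding I_def by (subst sum.Sigma) auto
    have lvl: "(\<Sum>n<N. bridge_level n t \<omega>) = (\<Sum>p\<in>I. \<xi> p \<omega> * schauder p t)" for t \<omega>
      unfolding bridge_level_def using sumI[of "\<lambda>p. \<xi> p \<omega> * schauder p t"] by simp
    have "S N \<omega> = (\<Sum>p\<in>I. (\<Sum>k\<in>K. a k * schauder p (u k)) * \<xi> p \<omega>)" for \<omega>
      unfolding S_def lvl
      by (simp add: sum_distrib_left sum_distrib_right sum.swap[of _ K I] mult_ac)
    then have "expectation (\<lambda>\<omega>. iexp (S N \<omega>)) = exp (- (\<Sum>p\<in>I. (\<Sum>k\<in>K. a k * schauder p (u k))\<^sup>2) / 2)"
      by (simp only: expectation_iexp_noise_sum[OF I])
    also have "(\<Sum>p\<in>I. (\<Sum>k\<in>K. a k * schauder p (u k))\<^sup>2) = (\<Sum>k\<in>K. \<Sum>l\<in>K. a k * a l * \<kappa> N (u k) (u l))"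
    proof -
      have "(\<Sum>p\<in>I. (\<Sum>k\<in>K. a k * schauder p (u k))\<^sup>2)
          = (\<Sum>p\<in>I. \<Sum>k\<in>K. \<Sum>l\<in>K. a k * a l * (schauder p (u k) * schauder p (u l)))"
        by (simp add: power2_eq_square sum_product mult_ac)
      also have "\<dots> = (\<Sum>k\<in>K. \<Sum>l\<in>K. \<Sum>p\<in>I. a k * a l * (schauder p (u k) * schauder p (u l)))"
        by (subst sum.swap, intro sum.cong refl, rule sum.swap)
      moreover have "\<kappa> N s t = (\<Sum>p\<in>I. schauder p s * schauder p t)" for s t
        unfolding \<kappa>_def using sumI[of "\<lambda>p. schauder p s * schauder p t"] by simp
      ultimately show ?thesis by (simp add: sum_distrib_left)
    qed
    finally show ?thesis .
  qed
  moreover have "(\<lambda>N. complex_of_real (exp (- (\<Sum>k\<in>K. \<Sum>l\<in>K. a k * a l * \<kappa> N (u k) (u l)) / 2))) \<longlonglongrightarrow>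
    exp (- (\<Sum>k\<in>K. \<Sum>l\<in>K. a k * a l * bridge_cov (u k) (u l)) / 2)"
    unfolding \<kappa>_def using u by (intro tendsto_intros sum_schauder_product_tendsto) auto
  ultimately show "(\<lambda>N. expectation (\<lambda>\<omega>. iexp (S N \<omega>))) \<longlonglongrightarrow>
    exp (- (\<Sum>k\<in>K. \<Sum>l\<in>K. a k * a l * bridge_cov (u k) (u l)) / 2)" by simp
qed

text \<open>Doob's time change turns the bridge on \<open>[0, 1)\<close> into a Brownian motion on \<open>[0, \<infinity>)\<close>.\<close>

definition wiener :: "real \<Rightarrow> 'a \<Rightarrow> real" where
  "wiener t \<omega> = (1 + t) * bridge (t / (1 + t)) \<omega>"

lemma wiener_measurable [measurable]: "wiener t \<in> borel_measurable M"
  unfolding wiener_def by measurable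

text \<open>The times form a family in which values may repeat. This matters for consecutive
  increments, which share endpoints, and for the times \<open>v N\<close>, which are not known to be
  distinct.\<close>

lemma expectation_iexp_wiener:
  fixes \<tau> a :: "'k \<Rightarrow> real"
  assumes K: "finite K" and \<tau>: "\<And>k. k \<in> K \<Longrightarrow> 0 \<le> \<tau> k"
  shows "expectation (\<lambda>\<omega>. iexp (\<Sum>k\<in>K. a k * wiener (\<tau> k) \<omega>)) =
    exp (- (\<Sum>k\<in>K. \<Sum>l\<in>K. a k * a l * min (\<tau> k) (\<tau> l)) / 2)"
proof -
  \<comment> \<open>The map from \<open>t\<close> to \<open>t / (1 + t)\<close> is increasing, so
    for \<open>s \<le> t\<close> the kernel equals \<open>s / (1 + s) * (1 - t / (1 + t))\<close>,
    that is \<open>s / ((1 + s) * (1 + t))\<close>.\<close>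
  have *: "(1 + s) * (1 + t) * bridge_cov (s / (1 + s)) (t / (1 + t)) = min s t" if "0 \<le> s" "s \<le> t" for s t
  proof -
    have "s / (1 + s) \<le> t / (1 + t)" using that by (simp add: field_simps)
    moreover have "p * q * (a / p - a / p * (b / q)) = a * (q - b)" if "p \<noteq> 0" "q \<noteq> 0" for p q a b :: real
      using that by (simp add: field_simps)
    from this[of "1 + s" "1 + t" s t] have "(1 + s) * (1 + t) * (s / (1 + s) - s / (1 + s) * (t / (1 + t))) = s"
      using that by simp
    ultimately show ?thesis using that by (simp add: bridge_cov_def)
  qed
  have "bridge_cov s t = bridge_cov t s" for s t by (simp add: bridge_cov_def mult.commute min.commute)
  then have cov: "(1 + s) * (1 + t) * bridge_cov (s / (1 + s)) (t / (1 + t)) = min s t" if "0 \<le> s" "0 \<le> t" for s t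
    using *[of s t] *[of t s] that by (cases "s \<le> t") (auto simp: mult.commute min.commute)
  have "expectation (\<lambda>\<omega>. iexp (\<Sum>k\<in>K. a k * wiener (\<tau> k) \<omega>)) =
    expectation (\<lambda>\<omega>. iexp (\<Sum>k\<in>K. (a k * (1 + \<tau> k)) * bridge (\<tau> k / (1 + \<tau> k)) \<omega>))"
    by (simp add: wiener_def mult.assoc)
  also have "\<dots> = exp (- (\<Sum>k\<in>K. \<Sum>l\<in>K. (a k * (1 + \<tau> k)) * (a l * (1 + \<tau> l)) *
      bridge_cov (\<tau> k / (1 + \<tau> k)) (\<tau> l / (1 + \<tau> l))) / 2)"
  proof (rule expectation_iexp_bridge[OF K])
    fix k assume "k \<in> K"
    from \<tau>[OF this] show "0 \<le> \<tau> k / (1 + \<tau> k) \<and> \<tau> k / (1 + \<tau> k) < 1" by simp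
  qed
  also have "(\<Sum>k\<in>K. \<Sum>l\<in>K. (a k * (1 + \<tau> k)) * (a l * (1 + \<tau> l)) *
      bridge_cov (\<tau> k / (1 + \<tau> k)) (\<tau> l / (1 + \<tau> l))) = (\<Sum>k\<in>K. \<Sum>l\<in>K. a k * a l * min (\<tau> k) (\<tau> l))"
    by (intro sum.cong refl, subst cov[symmetric]) (use \<tau> in \<open>auto simp: mult_ac\<close>)
  finally show ?thesis .
qed

lemma standard_brownian_motion_wiener: "standard_brownian_motion wiener"
  unfolding standard_brownian_motion_def
proof (intro conjI allI impI ballI)
  fix \<omega>
  show "wiener 0 \<omega> = 0" by (simp add: wiener_def)
  show "continuous_on {0..} (\<lambda>t. wiener t \<omega>)"
    unfolding wiener_def
    by (intro continuous_intros continuous_on_compose2[OF continuous_on_bridge]) auto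
next
  fix s t :: real assume st: "0 \<le> s \<and> s < t"
  show "distributed M lborel (\<lambda>\<omega>. wiener t \<omega> - wiener s \<omega>) (normal_density 0 (sqrt (t - s)))"
  proof (rule distributed_normalI_iexp)
    fix c
    have "expectation (\<lambda>\<omega>. iexp (c * (wiener t \<omega> - wiener s \<omega>))) =
      expectation (\<lambda>\<omega>. iexp (\<Sum>b\<in>UNIV. (if b then c else - c) * wiener (if b then t else s) \<omega>))"
      by (simp add: UNIV_bool algebra_simps)
    also have "\<dots> = exp (- (c\<^sup>2 * (sqrt (t - s))\<^sup>2) / 2)"
      using st by (subst expectation_iexp_wiener) (auto simp: UNIV_bool power2_eq_square algebra_simps)
    finally show "expectation (\<lambda>\<omega>. iexp (c * (wiener t \<omega> - wiener s \<omega>))) = exp (- (c\<^sup>2 * (sqrt (t - s))\<^sup>2) / 2)" .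
  qed (use st in auto)
next
  fix n :: nat and t :: "nat \<Rightarrow> real"
  assume t: "0 \<le> t 0 \<and> (\<forall>i<n. t i < t (Suc i))"
  have mono: "t i \<le> t j" if "i \<le> j" "j \<le> n" for i j
    using that by (induction j rule: dec_induct) (use t in \<open>auto simp: less_imp_le order_trans[OF _ less_imp_le]\<close>)
  have nonneg: "0 \<le> t i" if "i \<le> n" for i using mono[of 0 i] t that by auto
  \<comment> \<open>Formulated for subsets \<open>I\<close> so that singletons give the marginal
    factors and the full range gives the joint characteristic function.\<close>
  have key: "expectation (\<lambda>\<omega>. iexp (\<Sum>i\<in>I. c i * (wiener (t (Suc i)) \<omega> - wiener (t i) \<omega>))) =
      exp (- (\<Sum>i\<in>I. (c i)\<^sup>2 * (t (Suc i) - t i)) / 2)" if I: "I \<subseteq> {..<n}" for I c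
  proof -
    have fI: "finite I" using I finite_subset by blast
    \<comment> \<open>Each increment becomes two indices, the Boolean marking the right endpoint, so
      that the formula for combinations of values of \<open>wiener\<close> applies.\<close>
    have sumb: "(\<Sum>p\<in>I \<times> UNIV. f p) = (\<Sum>i\<in>I. f (i, True) + f (i, False))" for f :: "nat \<times> bool \<Rightarrow> real"
    proof -
      have "(\<Sum>p\<in>I \<times> UNIV. f p) = (\<Sum>i\<in>I. \<Sum>b\<in>UNIV. f (i, b))"
        by (simp add: sum.cartesian_product)
      then show ?thesis by (simp add: UNIV_bool add.commute)
    qed
    have lin: "(\<Sum>i\<in>I. c i * (wiener (t (Suc i)) \<omega> - wiener (t i) \<omega>)) =
        (\<Sum>p\<in>I \<times> UNIV. (if snd p then c (fst p) else - c (fst p)) * wiener (if snd p then t (Suc (fst p)) else t (fst p)) \<omega>)" for \<omega>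
      unfolding sumb by (simp add: algebra_simps)
    have quad: "(\<Sum>p\<in>I \<times> UNIV. \<Sum>q\<in>I \<times> UNIV. (if snd p then c (fst p) else - c (fst p)) * (if snd q then c (fst q) else - c (fst q))
        * min (if snd p then t (Suc (fst p)) else t (fst p)) (if snd q then t (Suc (fst q)) else t (fst q)))
      = (\<Sum>i\<in>I. (c i)\<^sup>2 * (t (Suc i) - t i))"
    proof -
      \<comment> \<open>The mixed second difference of \<open>min\<close> is the length of the
        overlap of the two intervals, which is 0 for different members of a chain of consecutive
        intervals.\<close>
      have off: "min (t (Suc i)) (t (Suc j)) - min (t (Suc i)) (t j) - min (t i) (t (Suc j)) + min (t i) (t j)
          = (if i = j then t (Suc i) - t i else 0)" if "i \<in> I" "j \<in> I" for i j
      proof -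
        consider "i < j" | "i = j" | "j < i" by linarith
        then show ?thesis
          using mono[of "Suc i" j] mono[of "Suc j" i] mono[of i "Suc i"] mono[of j "Suc j"] that I
          by cases (auto simp: min_def subset_eq)
      qed
      have "(\<Sum>p\<in>I \<times> UNIV. \<Sum>q\<in>I \<times> UNIV. (if snd p then c (fst p) else - c (fst p)) * (if snd q then c (fst q) else - c (fst q))
        * min (if snd p then t (Suc (fst p)) else t (fst p)) (if snd q then t (Suc (fst q)) else t (fst q)))
        = (\<Sum>i\<in>I. \<Sum>j\<in>I. c i * c j * (min (t (Suc i)) (t (Suc j)) - min (t (Suc i)) (t j) - min (t i) (t (Suc j)) + min (t i) (t j)))"
        unfolding sumb by (simp add: algebra_simps sum.distrib sum_subtractf)
      also have "\<dots> = (\<Sum>i\<in>I. \<Sum>j\<in>I. if i = j then c i * c j * (t (Suc i) - t i) else 0)"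
        by (intro sum.cong refl) (simp add: off)
      finally show ?thesis using fI by (simp add: power2_eq_square)
    qed
    show ?thesis
      unfolding lin quad[symmetric]
      by (rule expectation_iexp_wiener) (use fI I nonneg in \<open>auto simp: subset_eq Suc_le_eq less_imp_le\<close>)
  qed
  show "indep_vars (\<lambda>_. borel) (\<lambda>i \<omega>. wiener (t (Suc i)) \<omega> - wiener (t i) \<omega>) {..<n}"
  proof (rule indep_varsI_iexp)
    fix c
    have 1: "expectation (\<lambda>\<omega>. iexp (c i * (wiener (t (Suc i)) \<omega> - wiener (t i) \<omega>))) =
      exp (- ((c i)\<^sup>2 * (t (Suc i) - t i)) / 2)" if "i < n" for i
      using key[of "{i}" c] that by simp
    have "expectation (\<lambda>\<omega>. iexp (\<Sum>i<n. c i * (wiener (t (Suc i)) \<omega> - wiener (t i) \<omega>))) =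
      exp (- (\<Sum>i<n. (c i)\<^sup>2 * (t (Suc i) - t i)) / 2)" by (rule key) simp
    also have "\<dots> = (\<Prod>i<n. complex_of_real (exp (- ((c i)\<^sup>2 * (t (Suc i) - t i)) / 2)))"
      by (rule prod_exp_neg_half[symmetric]) simp
    finally show "expectation (\<lambda>\<omega>. iexp (\<Sum>i<n. c i * (wiener (t (Suc i)) \<omega> - wiener (t i) \<omega>))) =
      (\<Prod>i<n. expectation (\<lambda>\<omega>. iexp (c i * (wiener (t (Suc i)) \<omega> - wiener (t i) \<omega>))))"
      using 1 by simp
  qed auto
qed measurable

end

text \<open>The sample space is that of \<open>M'\<close> in the final theorem. Coordinates are
  indexed by all reals; \<open>prod_encode\<close> places the pairs at distinct natural numbers, and
  a product measure seen through an injective choice of coordinates is again a product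
  measure.\<close>

lemma white_noise_exists: "\<exists>(M' :: (real \<Rightarrow> real) measure) \<xi>. white_noise M' \<xi>"
proof -
  interpret N: prob_space std_normal_distribution
    using real_dist_normal_dist by (simp add: real_distribution_def)
  interpret P: product_prob_space "\<lambda>_::real. std_normal_distribution" UNIV by unfold_locales
  define P where "P = PiM (UNIV :: real set) (\<lambda>_. std_normal_distribution)"
  define \<xi> where "\<xi> p \<omega> = \<omega> (real (prod_encode p))" for p and \<omega> :: "real \<Rightarrow> real"
  have comp: "distr P borel (\<lambda>\<omega>. \<omega> i) = std_normal_distribution" for i
  proof -
    have "distr P borel (\<lambda>\<omega>. \<omega> i) = distr P std_normal_distribution (\<lambda>\<omega>. \<omega> i)"
      by (rule distr_cong) auto
    then show ?thesis using P.PiM_component[of i] by (simp add: P_def)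
  qed
  have [measurable]: "(\<lambda>\<omega>. \<omega> i) \<in> borel_measurable P" for i unfolding P_def by measurable
  interpret prob_space P unfolding P_def by unfold_locales
  have "white_noise P \<xi>"
  proof
    fix p
    have "distr P lborel (\<xi> p) = distr P borel (\<lambda>\<omega>. \<omega> (real (prod_encode p)))"
      by (rule distr_cong) (auto simp: \<xi>_def)
    then show "distributed P lborel (\<xi> p) std_normal_density"
      unfolding distributed_def comp by (simp add: \<xi>_def[abs_def])
  next
    have "distr P (PiM UNIV (\<lambda>_. borel)) (\<lambda>\<omega>. \<lambda>p\<in>UNIV. \<xi> p \<omega>) =
      distr P (PiM UNIV (\<lambda>_. std_normal_distribution)) (\<lambda>\<omega>. \<lambda>p\<in>UNIV. \<omega> (real (prod_encode p)))"
      by (intro distr_cong sets_PiM_cong) (auto simp: \<xi>_def)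
    also have "\<dots> = PiM UNIV (\<lambda>_. std_normal_distribution)"
      unfolding P_def by (rule distr_PiM_reindex[where M = "\<lambda>_. std_normal_distribution"])
        (auto intro!: injI simp: N.prob_space_axioms)
    also have "\<dots> = PiM UNIV (\<lambda>p. distr P borel (\<xi> p))"
      by (simp add: \<xi>_def[abs_def] comp)
    finally show "indep_vars (\<lambda>_. borel) \<xi> UNIV"
      by (subst indep_vars_iff_distr_eq_PiM) (auto simp: \<xi>_def[abs_def])
  qed
  then show ?thesis by blast
qed

section \<open>Covariance of fractional Brownian motion\<close>

text \<open>Away from 0 the function is smooth, so its second difference has order
  \<open>e^2\<close>, which is negligible against \<open>e powr p\<close> because
  \<open>p < 2\<close>.\<close>

lemma powr_second_difference:
  fixes x p :: real
  assumes "x \<noteq> 0" "1 < p" "p < 2"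
  shows "((\<lambda>e. (\<bar>x - e\<bar> powr p + \<bar>x + e\<bar> powr p - 2 * \<bar>x\<bar> powr p) / e powr p) \<longlongrightarrow> 0) (at_right 0)"
proof -
  have pos: "((\<lambda>e. (\<bar>y - e\<bar> powr p + \<bar>y + e\<bar> powr p - 2 * \<bar>y\<bar> powr p) / e powr p) \<longlongrightarrow> 0) (at_right 0)"
    if "y > 0" for y :: real
  proof (rule Lim_transform_eventually)
    show "((\<lambda>e. ((y - e) powr p + (y + e) powr p - 2 * y powr p) / e powr p) \<longlongrightarrow> 0) (at_right 0)"
      using that assms by real_asymp
    have "\<forall>\<^sub>F e in at_right 0. 0 < e \<and> e < y"
      using that by (auto simp: eventually_at_right_field)
    then show "\<forall>\<^sub>F e in at_right 0. ((y - e) powr p + (y + e) powr p - 2 * y powr p) / e powr p =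
      (\<bar>y - e\<bar> powr p + \<bar>y + e\<bar> powr p - 2 * \<bar>y\<bar> powr p) / e powr p"
      by eventually_elim (use that in auto)
  qed
  show ?thesis
  proof (cases "x > 0")
    case False
    then have "- x > 0" using assms by simp
    moreover have "\<bar>- x - e\<bar> = \<bar>x + e\<bar>" "\<bar>- x + e\<bar> = \<bar>x - e\<bar>" for e by auto
    ultimately show ?thesis using pos[of "- x"] by (simp add: add.commute)
  qed (rule pos)
qed

text \<open>Since \<open>p < 2\<close>, the function \<open>s \<mapsto> |t i - s|^p\<close> has a singular second difference at \<open>s = t i\<close> only,
  which isolates the coefficient \<open>c i\<close>.\<close>

lemma powr_kernel_independent:
  fixes t c :: "'i \<Rightarrow> real"
  assumes I: "finite I" "inj_on t I" and t: "\<And>i. i \<in> I \<Longrightarrow> 0 < t i" and p: "1 < p" "p < 2"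
    and eq: "\<And>s. 0 \<le> s \<Longrightarrow> (\<Sum>i\<in>I. c i * (t i powr p + s powr p - \<bar>t i - s\<bar> powr p)) = 0"
    and k: "k \<in> I"
  shows "c k = 0"
proof -
  define D where "D x e = (\<bar>x - e\<bar> powr p + \<bar>x + e\<bar> powr p - 2 * \<bar>x\<bar> powr p) / e powr p" for x e :: real
  have D: "(D x \<longlongrightarrow> 0) (at_right 0)" if "x \<noteq> 0" for x
    using powr_second_difference[OF that p] by (simp add: D_def[abs_def])
  have D0: "(D 0 \<longlongrightarrow> 2) (at_right 0)"
    unfolding D_def[abs_def] using p by real_asymp
  \<comment> \<open>Normalised second difference of \<open>eq\<close> in \<open>s\<close> at
    \<open>t k\<close>, term by term: the constant \<open>t i powr p\<close> cancels,
    \<open>s powr p\<close> contributes \<open>D (t k)\<close>, which tends to 0 since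
    \<open>t k > 0\<close>, and the kernel contributes \<open>D (t i - t k)\<close>, which for
    distinct times tends to 2 only if \<open>i = k\<close>. What survives is
    \<open>- 2 * c k\<close>.\<close>
  have "((\<lambda>e. \<Sum>i\<in>I. c i * (D (t k) e - D (t i - t k) e)) \<longlongrightarrow> (\<Sum>i\<in>I. c i * (0 - (if i = k then 2 else 0)))) (at_right 0)"
  proof (intro tendsto_intros)
    show "(D (t k) \<longlongrightarrow> 0) (at_right 0)" using t[OF k] by (intro D) simp
    show "(D (t i - t k) \<longlongrightarrow> (if i = k then 2 else 0)) (at_right 0)" if "i \<in> I" for i
      using D0 D[of "t i - t k"] inj_onD[OF I(2), of i k] that k by auto
  qed
  moreover have "\<forall>\<^sub>F e in at_right 0. (\<Sum>i\<in>I. c i * (D (t k) e - D (t i - t k) e)) = 0"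
  proof -
    \<comment> \<open>The bound \<open>e < t k\<close> keeps all three evaluation points
      nonnegative, where \<open>eq\<close> is available.\<close>
    have "\<forall>\<^sub>F e in at_right 0. 0 < e \<and> e < t k"
      using t[OF k] by (auto simp: eventually_at_right_field)
    then show ?thesis
    proof eventually_elim
      case (elim e)
      define f where "f i s = c i * (t i powr p + s powr p - \<bar>t i - s\<bar> powr p)" for i s
      have "c i * (D (t k) e - D (t i - t k) e) = (f i (t k - e) + f i (t k + e) - 2 * f i (t k)) / e powr p" if "i \<in> I" for i
      proof -
        have "\<bar>t i - (t k - e)\<bar> = \<bar>t i - t k + e\<bar>" "\<bar>t i - (t k + e)\<bar> = \<bar>t i - t k - e\<bar>" by auto
        then show ?thesis using elim by (simp add: f_def D_def field_simps)
      qed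
      then have "(\<Sum>i\<in>I. c i * (D (t k) e - D (t i - t k) e)) = (\<Sum>i\<in>I. (f i (t k - e) + f i (t k + e) - 2 * f i (t k)) / e powr p)"
        by (intro sum.cong) auto
      also have "\<dots> = ((\<Sum>i\<in>I. f i (t k - e)) + (\<Sum>i\<in>I. f i (t k + e)) - 2 * (\<Sum>i\<in>I. f i (t k))) / e powr p"
        by (simp only: sum_divide_distrib[symmetric] sum.distrib sum_subtractf sum_distrib_left)
      also have "\<dots> = 0" using eq[of "t k - e"] eq[of "t k + e"] eq[of "t k"] elim by (simp add: f_def)
      finally show ?case .
    qed
  qed
  ultimately have "((\<lambda>e. 0 :: real) \<longlongrightarrow> (\<Sum>i\<in>I. c i * (0 - (if i = k then 2 else 0)))) (at_right (0 :: real))"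
    by (rule Lim_transform_eventually)
  then have "(\<Sum>i\<in>I. c i * (0 - (if i = k then 2 else 0))) = 0"
    by (simp add: tendsto_const_iff)
  also have "(\<Sum>i\<in>I. c i * (0 - (if i = k then 2 else 0))) = (\<Sum>i\<in>I. if i = k then - 2 * c k else 0)"
    by (intro sum.cong) auto
  finally show ?thesis using I k by simp
qed

definition fbm_cov :: "real \<Rightarrow> real \<Rightarrow> real \<Rightarrow> real" where
  "fbm_cov H s t = (s powr (2 * H) + t powr (2 * H) - \<bar>s - t\<bar> powr (2 * H)) / 2"

section \<open>Moments and characteristic functions of fractional Brownian motion\<close>

context prob_space
begin

text \<open>\<open>gaussian_process\<close> attaches coefficients to times, not to indices;
  injectivity of \<open>\<tau>\<close> allows them to be transported.\<close>

lemma gaussian_process_linear_combination: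
  fixes \<tau> a :: "'i \<Rightarrow> real"
  assumes X: "gaussian_process T X" and I: "finite I" "inj_on \<tau> I" "\<tau> ` I \<subseteq> T"
  shows "gaussian_rv (\<lambda>\<omega>. \<Sum>i\<in>I. a i * X (\<tau> i) \<omega>)"
proof -
  have "(\<Sum>i\<in>I. a i * X (\<tau> i) \<omega>) = (\<Sum>t\<in>\<tau> ` I. a (the_inv_into I \<tau> t) * X t \<omega>)" for \<omega>
    using I by (simp add: sum.reindex the_inv_into_f_f)
  then show ?thesis using X I by (simp add: gaussian_process_def)
qed

lemma fbm_gaussian_rv:
  assumes "fractional_brownian_motion H B" "0 \<le> t"
  shows "gaussian_rv (B t)"
  using gaussian_process_linear_combination[of "{0..}" B "{t}" "\<lambda>t. t" "\<lambda>_. 1"] assms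
  by (simp add: fractional_brownian_motion_def)

text \<open>The moment conditions in \<open>fractional_brownian_motion\<close> are equations between
  Bochner integrals and do not give integrability by themselves; it comes from Gaussianity.\<close>

lemma fbm_integrable:
  assumes B: "fractional_brownian_motion H B" and s: "0 \<le> s" and t: "0 \<le> t"
  shows "integrable M (B t)" "integrable M (\<lambda>\<omega>. B s \<omega> * B t \<omega>)"
proof -
  note g = gaussian_rv_square_integrable[OF fbm_gaussian_rv[OF B]]
  show "integrable M (B t)" by (rule g[OF t])
  have [measurable]: "B s \<in> borel_measurable M" "B t \<in> borel_measurable M"
    using g(1)[OF s] g(1)[OF t] by auto
  show "integrable M (\<lambda>\<omega>. B s \<omega> * B t \<omega>)"
  proof (rule Bochner_Integration.integrable_bound[OF Bochner_Integration.integrable_add[OF g(2)[OF s] g(2)[OF t]]])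
    show "AE \<omega> in M. norm (B s \<omega> * B t \<omega>) \<le> norm ((B s \<omega>)\<^sup>2 + (B t \<omega>)\<^sup>2)"
    proof (intro always_eventually allI)
      have "\<bar>x * y\<bar> \<le> x\<^sup>2 + y\<^sup>2" for x y :: real
        using sum_squares_bound[of "\<bar>x\<bar>" "\<bar>y\<bar>"] abs_ge_zero[of "x * y"]
        unfolding power2_abs abs_mult by linarith
      then show "norm (B s \<omega> * B t \<omega>) \<le> norm ((B s \<omega>)\<^sup>2 + (B t \<omega>)\<^sup>2)" for \<omega>
        by simp
    qed
  qed simp
qed

lemma fbm_covariance:
  assumes "fractional_brownian_motion H B" "0 \<le> s" "0 \<le> t"
  shows "expectation (\<lambda>\<omega>. B s \<omega> * B t \<omega>) = fbm_cov H s t"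
  using assms by (simp add: fractional_brownian_motion_def fbm_cov_def)

lemma fbm_combination_covariance:
  fixes \<tau> a :: "'i \<Rightarrow> real"
  assumes B: "fractional_brownian_motion H B" and \<tau>: "\<And>i. i \<in> I \<Longrightarrow> 0 \<le> \<tau> i" and s: "0 \<le> s"
  shows "integrable M (\<lambda>\<omega>. (\<Sum>i\<in>I. a i * B (\<tau> i) \<omega>) * B s \<omega>)"
    and "expectation (\<lambda>\<omega>. (\<Sum>i\<in>I. a i * B (\<tau> i) \<omega>) * B s \<omega>) = (\<Sum>i\<in>I. a i * fbm_cov H (\<tau> i) s)"
proof -
  have i: "integrable M (\<lambda>\<omega>. a i * (B (\<tau> i) \<omega> * B s \<omega>))" if "i \<in> I" for i
    using fbm_integrable(2)[OF B \<tau>[OF that] s] by simp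
  show "integrable M (\<lambda>\<omega>. (\<Sum>i\<in>I. a i * B (\<tau> i) \<omega>) * B s \<omega>)"
    unfolding sum_distrib_right mult.assoc by (intro Bochner_Integration.integrable_sum i)
  have "expectation (\<lambda>\<omega>. (\<Sum>i\<in>I. a i * B (\<tau> i) \<omega>) * B s \<omega>) = (\<Sum>i\<in>I. expectation (\<lambda>\<omega>. a i * (B (\<tau> i) \<omega> * B s \<omega>)))"
    unfolding sum_distrib_right mult.assoc by (rule Bochner_Integration.integral_sum) (rule i)
  then show "expectation (\<lambda>\<omega>. (\<Sum>i\<in>I. a i * B (\<tau> i) \<omega>) * B s \<omega>) = (\<Sum>i\<in>I. a i * fbm_cov H (\<tau> i) s)"
    using fbm_covariance[OF B \<tau> s] by simp
qed

lemma fbm_combination_moments: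
  fixes \<tau> a :: "'i \<Rightarrow> real"
  assumes B: "fractional_brownian_motion H B" and \<tau>: "\<And>i. i \<in> I \<Longrightarrow> 0 \<le> \<tau> i"
  shows "expectation (\<lambda>\<omega>. \<Sum>i\<in>I. a i * B (\<tau> i) \<omega>) = 0"
    and "integrable M (\<lambda>\<omega>. (\<Sum>i\<in>I. a i * B (\<tau> i) \<omega>)\<^sup>2)"
    and "expectation (\<lambda>\<omega>. (\<Sum>i\<in>I. a i * B (\<tau> i) \<omega>)\<^sup>2) = (\<Sum>i\<in>I. \<Sum>j\<in>I. a i * a j * fbm_cov H (\<tau> i) (\<tau> j))"
proof -
  have "expectation (B (\<tau> i)) = 0" if "i \<in> I" for i
    using B \<tau>[OF that] by (simp add: fractional_brownian_motion_def)
  then show "expectation (\<lambda>\<omega>. \<Sum>i\<in>I. a i * B (\<tau> i) \<omega>) = 0"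
    using fbm_integrable(1)[OF B order_refl \<tau>] by (subst Bochner_Integration.integral_sum) auto
  have sq: "(\<Sum>i\<in>I. a i * B (\<tau> i) \<omega>)\<^sup>2 = (\<Sum>j\<in>I. a j * ((\<Sum>i\<in>I. a i * B (\<tau> i) \<omega>) * B (\<tau> j) \<omega>))" for \<omega>
    by (simp add: power2_eq_square sum_distrib_left mult_ac)
  note c = fbm_combination_covariance[OF B \<tau> \<tau>]
  show "integrable M (\<lambda>\<omega>. (\<Sum>i\<in>I. a i * B (\<tau> i) \<omega>)\<^sup>2)"
    unfolding sq by (intro Bochner_Integration.integrable_sum integrable_mult_right c)
  have "expectation (\<lambda>\<omega>. (\<Sum>i\<in>I. a i * B (\<tau> i) \<omega>)\<^sup>2) = (\<Sum>j\<in>I. a j * (\<Sum>i\<in>I. a i * fbm_cov H (\<tau> i) (\<tau> j)))"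
    unfolding sq by (subst Bochner_Integration.integral_sum) (auto intro!: integrable_mult_right sum.cong simp: c)
  also have "\<dots> = (\<Sum>i\<in>I. \<Sum>j\<in>I. a i * a j * fbm_cov H (\<tau> i) (\<tau> j))"
    by (subst sum.swap) (simp add: sum_distrib_left mult_ac)
  finally show "expectation (\<lambda>\<omega>. (\<Sum>i\<in>I. a i * B (\<tau> i) \<omega>)\<^sup>2) = (\<Sum>i\<in>I. \<Sum>j\<in>I. a i * a j * fbm_cov H (\<tau> i) (\<tau> j))" .
qed

lemma fbm_cov_nonneg_definite:
  fixes \<tau> a :: "'i \<Rightarrow> real"
  assumes B: "fractional_brownian_motion H B" and \<tau>: "\<And>i. i \<in> I \<Longrightarrow> 0 \<le> \<tau> i"
  shows "0 \<le> (\<Sum>i\<in>I. \<Sum>j\<in>I. a i * a j * fbm_cov H (\<tau> i) (\<tau> j))"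
proof -
  have "0 \<le> expectation (\<lambda>\<omega>. (\<Sum>i\<in>I. a i * B (\<tau> i) \<omega>)\<^sup>2)" by simp
  also have "\<dots> = (\<Sum>i\<in>I. \<Sum>j\<in>I. a i * a j * fbm_cov H (\<tau> i) (\<tau> j))"
    by (rule fbm_combination_moments(3)[OF B \<tau>])
  finally show ?thesis .
qed

text \<open>A null vector of the form gives a combination that is almost surely 0. It is then
  uncorrelated with \<open>B s\<close> for every \<open>s \<ge> 0\<close>, not only at the sampled
  times, so a whole function of \<open>s\<close> vanishes and its kinks can be inspected.\<close>

lemma fbm_cov_definite:
  fixes \<tau> a :: "'i \<Rightarrow> real"
  assumes B: "fractional_brownian_motion H B" and H: "1 / 2 < H" "H < 1"
    and I: "finite I" "inj_on \<tau> I" and \<tau>: "\<And>i. i \<in> I \<Longrightarrow> 0 < \<tau> i"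
    and 0: "(\<Sum>i\<in>I. \<Sum>j\<in>I. a i * a j * fbm_cov H (\<tau> i) (\<tau> j)) = 0" and k: "k \<in> I"
  shows "a k = 0"
proof (rule powr_kernel_independent[OF I \<tau> _ _ _ k])
  let ?Y = "\<lambda>\<omega>. \<Sum>i\<in>I. a i * B (\<tau> i) \<omega>"
  have \<tau>0: "0 \<le> \<tau> i" if "i \<in> I" for i using \<tau>[OF that] by simp
  have "AE \<omega> in M. (?Y \<omega>)\<^sup>2 = 0"
    using 0 fbm_combination_moments(2,3)[OF B \<tau>0, where a = a]
    by (subst integral_nonneg_eq_0_iff_AE[symmetric]) auto
  then have Y0: "AE \<omega> in M. ?Y \<omega> = 0" by simp
  fix s :: real assume s: "0 \<le> s"
  have "expectation (\<lambda>\<omega>. ?Y \<omega> * B s \<omega>) = expectation (\<lambda>_. 0)"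
    using fbm_combination_covariance(1)[OF B \<tau>0 s, where a = a] Y0 by (intro integral_cong_AE) auto
  then have "0 = 2 * (\<Sum>i\<in>I. a i * fbm_cov H (\<tau> i) s)"
    using fbm_combination_covariance(2)[OF B \<tau>0 s, where a = a] by simp
  then show "(\<Sum>i\<in>I. a i * (\<tau> i powr (2 * H) + s powr (2 * H) - \<bar>\<tau> i - s\<bar> powr (2 * H))) = 0"
    by (simp add: fbm_cov_def sum_distrib_left)
qed (use H in auto)

lemma expectation_iexp_fbm_combination:
  fixes \<tau> a :: "'i \<Rightarrow> real"
  assumes B: "fractional_brownian_motion H B"
    and I: "finite I" "inj_on \<tau> I" and \<tau>: "\<And>i. i \<in> I \<Longrightarrow> 0 \<le> \<tau> i"
  shows "expectation (\<lambda>\<omega>. iexp (\<Sum>i\<in>I. a i * B (\<tau> i) \<omega>)) =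
    exp (- (\<Sum>i\<in>I. \<Sum>j\<in>I. a i * a j * fbm_cov H (\<tau> i) (\<tau> j)) / 2)"
proof -
  have "gaussian_rv (\<lambda>\<omega>. \<Sum>i\<in>I. a i * B (\<tau> i) \<omega>)"
    using B I \<tau> by (intro gaussian_process_linear_combination) (auto simp: fractional_brownian_motion_def)
  from expectation_iexp_gaussian[OF this] show ?thesis
    using fbm_combination_moments[OF B \<tau>, where a = a] by simp
qed

lemma expectation_iexp_mixed_fbm_combination:
  fixes \<tau> a :: "'i \<Rightarrow> real"
  assumes B: "\<And>r. r \<in> R \<Longrightarrow> fractional_brownian_motion (H r) (B r)" and indep: "indep_processes R B"
    and R: "finite R" and I: "finite I" "inj_on \<tau> I" and \<tau>: "\<And>i. i \<in> I \<Longrightarrow> 0 \<le> \<tau> i"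
  shows "expectation (\<lambda>\<omega>. iexp (\<Sum>i\<in>I. a i * (\<Sum>r\<in>R. B r (\<tau> i) \<omega>))) =
    exp (- (\<Sum>i\<in>I. \<Sum>j\<in>I. a i * a j * (\<Sum>r\<in>R. fbm_cov (H r) (\<tau> i) (\<tau> j))) / 2)"
proof -
  \<comment> \<open>Each combination reads finitely many coordinates of the path, all at times
    \<open>\<tau> i \<ge> 0\<close>, so it is a measurable functional on the path space and inherits
    independence.\<close>
  have "indep_vars (\<lambda>_. borel) (\<lambda>r \<omega>. (\<lambda>x. \<Sum>i\<in>I. a i * x (\<tau> i)) (\<lambda>t\<in>{0..}. B r t \<omega>)) R"
    by (rule indep_vars_compose2[OF indep[unfolded indep_processes_def]]) (use \<tau> in \<open>auto intro!: borel_measurable_sum borel_measurable_times measurable_component_singleton\<close>)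
  then have ind: "indep_vars (\<lambda>_. borel) (\<lambda>r \<omega>. \<Sum>i\<in>I. a i * B r (\<tau> i) \<omega>) R"
    using \<tau> by (simp cong: sum.cong)
  have "expectation (\<lambda>\<omega>. iexp (\<Sum>i\<in>I. a i * (\<Sum>r\<in>R. B r (\<tau> i) \<omega>))) =
    expectation (\<lambda>\<omega>. iexp (\<Sum>r\<in>R. \<Sum>i\<in>I. a i * B r (\<tau> i) \<omega>))"
    unfolding sum_distrib_left by (subst sum.swap) (rule refl)
  also have "\<dots> = (\<Prod>r\<in>R. expectation (\<lambda>\<omega>. iexp (\<Sum>i\<in>I. a i * B r (\<tau> i) \<omega>)))"
    by (rule expectation_iexp_sum_indep[OF ind])
  also have "\<dots> = (\<Prod>r\<in>R. complex_of_real (exp (- (\<Sum>i\<in>I. \<Sum>j\<in>I. a i * a j * fbm_cov (H r) (\<tau> i) (\<tau> j)) / 2)))"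
    by (intro prod.cong refl expectation_iexp_fbm_combination B I \<tau>)
  also have "\<dots> = exp (- (\<Sum>r\<in>R. \<Sum>i\<in>I. \<Sum>j\<in>I. a i * a j * fbm_cov (H r) (\<tau> i) (\<tau> j)) / 2)"
    by (rule prod_exp_neg_half[OF R])
  also have "(\<Sum>r\<in>R. \<Sum>i\<in>I. \<Sum>j\<in>I. a i * a j * fbm_cov (H r) (\<tau> i) (\<tau> j)) =
      (\<Sum>i\<in>I. \<Sum>j\<in>I. a i * a j * (\<Sum>r\<in>R. fbm_cov (H r) (\<tau> i) (\<tau> j)))"
    by (subst sum.swap, intro sum.cong refl, subst sum.swap) (simp add: sum_distrib_left)
  finally show ?thesis .
qed

end

section \<open>Generalized least squares\<close>

text \<open>One infinite array \<open>\<Gamma>\<close> carries all sample sizes: the matrix for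
  \<open>N\<close> is its leading block, so the samples are nested and weights for different sizes
  can be compared in one bilinear form.\<close>

locale gls =
  fixes \<Gamma> :: "nat \<Rightarrow> nat \<Rightarrow> real" and x :: "nat \<Rightarrow> real"
  assumes sym: "\<Gamma> i j = \<Gamma> j i"
    and nonneg_definite: "0 \<le> (\<Sum>i<N. \<Sum>j<N. a i * a j * \<Gamma> i j)"
    and definite: "(\<Sum>i<N. \<Sum>j<N. a i * a j * \<Gamma> i j) = 0 \<Longrightarrow> i < N \<Longrightarrow> a i = 0"
    and x_pos: "0 < x i"
begin

definition gram :: "nat \<Rightarrow> real mat" where
  "gram N = mat N N (\<lambda>(i, j). \<Gamma> i j)"

definition gram_inv :: "nat \<Rightarrow> real mat" where
  "gram_inv N = the (mat_inverse (gram N))"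

definition design :: "nat \<Rightarrow> real vec" where
  "design N = vec N x"

definition d :: "nat \<Rightarrow> real" where
  "d N = scalar_prod (design N) (gram_inv N *\<^sub>v design N)"

text \<open>The weights are padded by zeros, so that combinations for different sample sizes can be
  added as functions on \<open>nat\<close>.\<close>

definition w :: "nat \<Rightarrow> nat \<Rightarrow> real" where
  "w N i = (if i < N then (gram_inv N *\<^sub>v design N) $ i / d N else 0)"

lemma gram_carrier [simp]: "gram N \<in> carrier_mat N N"
  and design_carrier [simp]: "design N \<in> carrier_vec N"
  by (auto simp: gram_def design_def)

lemma dim_gram: "dim_row (gram N) = N"
  by (simp add: gram_def)

lemma gram_mult_vec:
  assumes "v \<in> carrier_vec N" "i < N"
  shows "(gram N *\<^sub>v v) $ i = (\<Sum>j<N. \<Gamma> i j * v $ j)"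
  using assms by (auto simp: gram_def scalar_prod_def atLeast0LessThan intro!: sum.cong)

text \<open>A kernel vector would annihilate the quadratic form, so definiteness makes the
  determinant nonzero. This justifies the \<open>the\<close> in \<open>gram_inv\<close>.\<close>

lemma gram_inv:
  "gram N * gram_inv N = 1\<^sub>m N" "gram_inv N * gram N = 1\<^sub>m N" "gram_inv N \<in> carrier_mat N N"
proof -
  have "det (gram N) \<noteq> 0"
  proof
    assume "det (gram N) = 0"
    then obtain v where v: "v \<in> carrier_vec N" "v \<noteq> 0\<^sub>v N" "gram N *\<^sub>v v = 0\<^sub>v N"
      using det_0_iff_vec_prod_zero_field[OF gram_carrier] by blast
    have "(\<Sum>i<N. \<Sum>j<N. v $ i * v $ j * \<Gamma> i j) = (\<Sum>i<N. v $ i * (gram N *\<^sub>v v) $ i)"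
      using v(1) by (intro sum.cong) (auto simp: gram_mult_vec sum_distrib_left mult_ac)
    also have "\<dots> = 0" using v by simp
    finally have "v $ i = 0" if "i < N" for i using definite[of "\<lambda>i. v $ i" N i] that by simp
    then show False using v by auto
  qed
  from det_non_zero_imp_unit[OF gram_carrier this, of "()"]
  have "mat_inverse (gram N) \<noteq> None"
    using mat_inverse(1)[OF gram_carrier, where b = "()"] by auto
  then have "mat_inverse (gram N) = Some (gram_inv N)" by (auto simp: gram_inv_def)
  from mat_inverse(2)[OF gram_carrier this]
  show "gram N * gram_inv N = 1\<^sub>m N" "gram_inv N * gram N = 1\<^sub>m N" "gram_inv N \<in> carrier_mat N N"
    by auto
qed

lemma gram_inv_mult_carrier [simp]: "y \<in> carrier_vec N \<Longrightarrow> gram_inv N *\<^sub>v y \<in> carrier_vec N"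
  by (rule mult_mat_vec_carrier[OF gram_inv(3)])

lemma gram_gram_inv: "y \<in> carrier_vec N \<Longrightarrow> gram N *\<^sub>v (gram_inv N *\<^sub>v y) = y"
  using gram_inv by (simp flip: assoc_mult_mat_vec[OF gram_carrier gram_inv(3)])

lemma gram_self_adjoint:
  assumes "u \<in> carrier_vec N" "v \<in> carrier_vec N"
  shows "scalar_prod (gram N *\<^sub>v u) v = scalar_prod u (gram N *\<^sub>v v)"
proof -
  have "scalar_prod (gram N *\<^sub>v u) v = (\<Sum>i<N. \<Sum>j<N. \<Gamma> i j * u $ j * v $ i)"
    using assms by (simp add: scalar_prod_def gram_mult_vec atLeast0LessThan sum_distrib_right)
  also have "\<dots> = (\<Sum>j<N. \<Sum>i<N. \<Gamma> j i * v $ i * u $ j)"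
    by (subst sum.swap) (simp add: sym mult_ac)
  also have "\<dots> = scalar_prod u (gram N *\<^sub>v v)"
    using assms unfolding scalar_prod_def
    by (simp add: gram_mult_vec atLeast0LessThan sum_distrib_left mult_ac dim_gram del: index_mult_mat_vec)
  finally show ?thesis .
qed

lemma d_pos:
  assumes "0 < N"
  shows "0 < d N"
proof -
  define u where "u = gram_inv N *\<^sub>v design N"
  have u: "u \<in> carrier_vec N" "gram N *\<^sub>v u = design N"
    by (simp_all add: u_def gram_gram_inv)
  have d: "d N = (\<Sum>i<N. \<Sum>j<N. u $ i * u $ j * \<Gamma> i j)"
  proof -
    have "d N = (\<Sum>i<N. (gram N *\<^sub>v u) $ i * u $ i)"
      using u by (simp add: d_def u_def[symmetric] scalar_prod_def atLeast0LessThan)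
    then show ?thesis using u(1) by (simp add: gram_mult_vec sum_distrib_left sum_distrib_right mult_ac)
  qed
  have "d N \<noteq> 0"
  proof
    assume "d N = 0"
    then have z: "u $ i = 0" if "i < N" for i using definite[of "\<lambda>i. u $ i" N i] that d by simp
    have "x 0 = (gram N *\<^sub>v u) $ 0" using assms u by (simp add: design_def)
    also have "\<dots> = 0" using assms u(1) z by (subst gram_mult_vec) auto
    finally show False using x_pos[of 0] by simp
  qed
  then show ?thesis using d nonneg_definite[where N = N and a = "\<lambda>i. u $ i"] by simp
qed

text \<open>Symmetry of the inverse enters indirectly: \<open>design N\<close> is written as
  \<open>gram N\<close> applied to \<open>gram_inv N *\<^sub>v design N\<close>, and
  \<open>gram N\<close> is moved to the other factor, where it cancels.\<close>

lemma estimator_eq_weighted_sum: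
  "scalar_prod (design N) (gram_inv N *\<^sub>v vec N y) / d N = (\<Sum>i<N. w N i * y i)"
proof -
  have "scalar_prod (design N) (gram_inv N *\<^sub>v vec N y) = scalar_prod (gram N *\<^sub>v (gram_inv N *\<^sub>v design N)) (gram_inv N *\<^sub>v vec N y)"
    by (simp add: gram_gram_inv)
  also have "\<dots> = scalar_prod (gram_inv N *\<^sub>v design N) (vec N y)"
    by (subst gram_self_adjoint) (simp_all add: gram_gram_inv)
  also have "\<dots> = (\<Sum>i<N. (gram_inv N *\<^sub>v design N) $ i * y i)"
    by (simp add: scalar_prod_def atLeast0LessThan)
  finally show ?thesis by (simp add: w_def sum_divide_distrib)
qed

lemma sum_w_x: "0 < N \<Longrightarrow> (\<Sum>i<N. w N i * x i) = 1"
  using estimator_eq_weighted_sum[of N x] d_pos[of N] by (simp add: d_def design_def)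

text \<open>Only the rows \<open>i < N\<close> are controlled. This is why
  \<open>cov_w_right\<close> asks \<open>a\<close> to vanish from \<open>N\<close> on.\<close>

lemma normal_equations:
  assumes "i < N" "N \<le> L"
  shows "(\<Sum>j<L. \<Gamma> i j * w N j) = x i / d N"
proof -
  have "(\<Sum>j<L. \<Gamma> i j * w N j) = (\<Sum>j<N. \<Gamma> i j * w N j)"
    using assms by (intro sum.mono_neutral_right) (auto simp: w_def)
  also have "\<dots> = (gram N *\<^sub>v (gram_inv N *\<^sub>v design N)) $ i / d N"
    using assms by (subst gram_mult_vec) (auto simp: w_def sum_divide_distrib)
  also have "\<dots> = x i / d N"
    using assms by (simp add: gram_gram_inv) (simp add: design_def)
  finally show ?thesis .
qed

section \<open>Covariances of linear combinations of the observations\<close>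

definition cov :: "nat \<Rightarrow> (nat \<Rightarrow> real) \<Rightarrow> (nat \<Rightarrow> real) \<Rightarrow> real" where
  "cov L a b = (\<Sum>i<L. \<Sum>j<L. a i * b j * \<Gamma> i j)"

lemma cov_commute: "cov L a b = cov L b a"
  unfolding cov_def by (subst sum.swap) (simp add: sym mult_ac)

lemma cov_diff: "cov L (\<lambda>i. a i - b i) (\<lambda>i. a i - b i) = cov L a a - 2 * cov L a b + cov L b b"
proof -
  have "cov L (\<lambda>i. a i - b i) (\<lambda>i. a i - b i) = cov L a a - cov L a b - cov L b a + cov L b b"
    by (simp add: cov_def algebra_simps sum.distrib sum_subtractf)
  then show ?thesis by (simp add: cov_commute[of L b a])
qed

lemma cov_nonneg: "0 \<le> cov L a a"
  unfolding cov_def by (rule nonneg_definite)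

text \<open>By the normal equations, the covariance of the estimator with any combination of the first
  \<open>N\<close> observations only depends on the mean of that combination.\<close>

lemma cov_w_right:
  assumes "N \<le> L" and a: "\<And>i. N \<le> i \<Longrightarrow> a i = 0"
  shows "cov L a (w N) = (\<Sum>i<N. a i * x i) / d N"
proof -
  have "cov L a (w N) = (\<Sum>i<L. a i * (\<Sum>j<L. \<Gamma> i j * w N j))"
    by (simp add: cov_def sum_distrib_left mult_ac)
  also have "\<dots> = (\<Sum>i<N. a i * (\<Sum>j<L. \<Gamma> i j * w N j))"
    using assms by (intro sum.mono_neutral_right) auto
  also have "\<dots> = (\<Sum>i<N. a i * x i) / d N"
    using assms(1) by (simp add: normal_equations sum_divide_distrib)
  finally show ?thesis .
qed

lemma cov_w_w:
  assumes "0 < N" "N \<le> K" "K \<le> L"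
  shows "cov L (w N) (w K) = 1 / d K"
proof -
  have "(\<Sum>i<K. w N i * x i) = (\<Sum>i<N. w N i * x i)"
    using assms by (intro sum.mono_neutral_right) (auto simp: w_def)
  then show ?thesis
    using assms cov_w_right[of K L "w N"] sum_w_x[of N] by (simp add: w_def[of N i for i])
qed

text \<open>The difference \<open>1 / d N - 1 / d K\<close> is itself a variance, that of the
  difference of the two estimators.\<close>

lemma inverse_d_antimono:
  assumes "0 < N" "N \<le> K"
  shows "1 / d K \<le> 1 / d N"
proof -
  have "0 \<le> cov K (\<lambda>i. w N i - w K i) (\<lambda>i. w N i - w K i)" by (rule cov_nonneg)
  then show ?thesis using assms by (simp add: cov_diff cov_w_w)
qed

lemma cov_w_w_min:
  assumes "0 < N" "0 < K" "N \<le> L" "K \<le> L"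
  shows "cov L (w N) (w K) = min (1 / d N) (1 / d K)"
proof (cases "N \<le> K")
  case True
  then show ?thesis using assms inverse_d_antimono[of N K] by (simp add: cov_w_w min_def)
next
  case False
  then show ?thesis using assms inverse_d_antimono[of K N]
    by (simp add: cov_commute[of L "w N"] cov_w_w min_def)
qed

text \<open>The estimator has smaller variance than the unbiased one that only uses the last observation.\<close>

lemma inverse_d_le: "1 / d (Suc N) \<le> \<Gamma> N N / (x N)\<^sup>2"
proof -
  define a where "a i = (if i = N then 1 / x N else 0)" for i
  have "cov (Suc N) a (w (Suc N)) = 1 / d (Suc N)"
    using x_pos[of N] by (subst cov_w_right) (auto simp: a_def)
  moreover have "cov (Suc N) a a = \<Gamma> N N / (x N)\<^sup>2"
    by (simp add: cov_def a_def power2_eq_square)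
  moreover have "cov (Suc N) (w (Suc N)) (w (Suc N)) = 1 / d (Suc N)" by (simp add: cov_w_w)
  moreover have "0 \<le> cov (Suc N) (\<lambda>i. a i - w (Suc N) i) (\<lambda>i. a i - w (Suc N) i)" by (rule cov_nonneg)
  ultimately show ?thesis by (simp add: cov_diff)
qed

lemma cov_sum:
  "cov L (\<lambda>i. \<Sum>N\<in>J. c N * u N i) (\<lambda>i. \<Sum>N\<in>J. c N * u N i) = (\<Sum>N\<in>J. \<Sum>K\<in>J. c N * c K * cov L (u N) (u K))"
proof -
  have "cov L (\<lambda>i. \<Sum>N\<in>J. c N * u N i) (\<lambda>i. \<Sum>N\<in>J. c N * u N i) =
    (\<Sum>i<L. \<Sum>j<L. \<Sum>N\<in>J. \<Sum>K\<in>J. c N * c K * (u N i * u K j * \<Gamma> i j))"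
    unfolding cov_def by (intro sum.cong refl) (subst sum_product, simp only: sum_distrib_right, intro sum.cong refl, simp)
  also have "\<dots> = (\<Sum>i<L. \<Sum>N\<in>J. \<Sum>K\<in>J. \<Sum>j<L. c N * c K * (u N i * u K j * \<Gamma> i j))"
    by (intro sum.cong refl, subst sum.swap, intro sum.cong refl, rule sum.swap)
  also have "\<dots> = (\<Sum>N\<in>J. \<Sum>K\<in>J. \<Sum>i<L. \<Sum>j<L. c N * c K * (u N i * u K j * \<Gamma> i j))"
    by (subst sum.swap, intro sum.cong refl, rule sum.swap)
  finally show ?thesis by (simp add: cov_def sum_distrib_left)
qed

end

section \<open>Law of the drift estimator\<close>

theorem corollary4p9:
  fixes M :: "'a measure" and B :: "nat \<Rightarrow> real \<Rightarrow> 'a \<Rightarrow> real"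
    and H :: "nat \<Rightarrow> real" and m :: nat and h \<theta> \<alpha> :: real
  defines "Z \<equiv> drift_process \<theta> \<alpha> m B"
  defines "\<theta>hat \<equiv> drift_estimator h m H Z"
  defines "v \<equiv> \<lambda>N. prob_space.variance M (\<theta>hat N)"
  assumes "prob_space M"
    and "h > 0" and "m \<ge> 1" and "\<alpha> > 0"
    and "\<And>r. r \<in> {1..m} \<Longrightarrow> 1 / 2 < H r \<and> H r < 1"
    and "\<And>r. r \<in> {1..m} \<Longrightarrow> prob_space.fractional_brownian_motion M (H r) (B r)"
    and "prob_space.indep_processes M {1..m} B"
  shows "antimono_on {1..} v \<and> v \<longlonglongrightarrow> 0 \<and>
    (\<exists>(M' :: (real \<Rightarrow> real) measure) W.
       prob_space M' \<and> prob_space.standard_brownian_motion M' W \<and>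
       distr M (PiM {1..} (\<lambda>_. borel)) (\<lambda>\<omega>. \<lambda>N\<in>{1..}. \<theta>hat N \<omega> - \<theta>) =
       distr M' (PiM {1..} (\<lambda>_. borel)) (\<lambda>\<omega>. \<lambda>N\<in>{1..}. W (v N) \<omega>))"
proof -
  interpret prob_space M by fact
  note h = \<open>h > 0\<close> and \<alpha> = \<open>\<alpha> > 0\<close> and H = assms(8) and B = assms(9) and indep = assms(10)
  \<comment> \<open>Counting from \<open>Suc i\<close> keeps time 0, where the covariance vanishes,
    out of the sample.\<close>
  define t where "t i = grid_time h (Suc i)" for i
  define \<Gamma> where "\<Gamma> i j = (\<Sum>r=1..m. fbm_cov (H r) (t i) (t j))" for i j
  define S where "S t \<omega> = (\<Sum>r=1..m. B r t \<omega>)" for t \<omega>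
  have t: "0 < t i" for i using h by (simp add: t_def grid_time_def)
  have inj: "inj_on t I" for I using h by (auto simp: t_def grid_time_def inj_on_def)
  have quad: "(\<Sum>i<N. \<Sum>j<N. a i * a j * \<Gamma> i j) = (\<Sum>r=1..m. \<Sum>i<N. \<Sum>j<N. a i * a j * fbm_cov (H r) (t i) (t j))" for N a
    unfolding \<Gamma>_def sum_distrib_left
    by (subst (2) sum.swap, subst sum.swap) (rule refl)
  have nonneg: "0 \<le> (\<Sum>i<N. \<Sum>j<N. a i * a j * fbm_cov (H r) (t i) (t j))" if "r \<in> {1..m}" for r N a
    using t by (intro fbm_cov_nonneg_definite[OF B[OF that]]) (simp add: less_imp_le)
  interpret gls \<Gamma> t
  proof
    show "\<Gamma> i j = \<Gamma> j i" for i j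
      by (simp add: \<Gamma>_def fbm_cov_def abs_minus_commute add.commute)
    show "0 \<le> (\<Sum>i<N. \<Sum>j<N. a i * a j * \<Gamma> i j)" for N a
      unfolding quad by (intro sum_nonneg nonneg)
    show "a i = 0" if 0: "(\<Sum>i<N. \<Sum>j<N. a i * a j * \<Gamma> i j) = 0" and i: "i < N" for N a i
    \<comment> \<open>A sum of nonnegative forms vanishes only if each of them does; as
      \<open>m \<ge> 1\<close>, definiteness of the first one is enough.\<close>
    proof (rule fbm_cov_definite[OF B _ _ _ inj t])
      show "1 \<in> {1..m}" using \<open>m \<ge> 1\<close> by simp
      then show "1 / 2 < H 1" "H 1 < 1" using H by blast+
      show "(\<Sum>i<N. \<Sum>j<N. a i * a j * fbm_cov (H 1) (t i) (t j)) = 0"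
        using 0 \<open>1 \<in> {1..m}\<close> unfolding quad by (subst (asm) sum_nonneg_eq_0_iff) (use nonneg in blast)+
    qed (use i in auto)
  qed (rule t)
  have cov_mat: "cov_mat h m H N = gram N" for N
    unfolding cov_mat_def gram_def \<Gamma>_def fbm_cov_def t_def Let_def by (simp add: sum_divide_distrib)
  have time_vec: "time_vec h N = design N" for N
    by (rule eq_vecI) (simp_all add: time_vec_def design_def t_def)
  have \<theta>hat: "\<theta>hat N \<omega> - \<theta> = (\<Sum>i<N. (\<alpha> * w N i) * S (t i) \<omega>)" if "0 < N" for N \<omega>
  proof -
    have "\<theta>hat N \<omega> = scalar_prod (design N) (gram_inv N *\<^sub>v vec N (\<lambda>i. Z (t i) \<omega>)) / d N"
      by (simp add: \<theta>hat_def drift_estimator_def info_def d_def cov_inv_def gram_inv_def cov_mat time_vec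
          obs_vec_def t_def)
    also have "\<dots> = (\<Sum>i<N. w N i * (\<theta> * t i + \<alpha> * S (t i) \<omega>))"
      by (simp add: estimator_eq_weighted_sum Z_def drift_process_def S_def)
    \<comment> \<open>The weights are unbiased, so the drift enters with factor 1 and only the noise
      is left after centring.\<close>
    also have "\<dots> = \<theta> * (\<Sum>i<N. w N i * t i) + (\<Sum>i<N. (\<alpha> * w N i) * S (t i) \<omega>)"
      by (simp add: algebra_simps sum.distrib sum_distrib_left)
    finally show ?thesis using sum_w_x[OF that] by simp
  qed
  have iexp_S: "expectation (\<lambda>\<omega>. iexp (\<Sum>i<N. a i * S (t i) \<omega>)) = exp (- cov N a a / 2)" for N a
    unfolding S_def cov_def \<Gamma>_def using t
    by (intro expectation_iexp_mixed_fbm_combination B indep inj) (auto simp: less_imp_le)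
  have iexp_\<theta>hat: "expectation (\<lambda>\<omega>. iexp (\<Sum>N\<in>J. c N * (\<theta>hat N \<omega> - \<theta>))) =
      exp (- (\<Sum>N\<in>J. \<Sum>K\<in>J. c N * c K * min (\<alpha>\<^sup>2 / d N) (\<alpha>\<^sup>2 / d K)) / 2)"
    if J: "finite J" "J \<subseteq> {1..}" for J c
  proof -
    \<comment> \<open>A common sample size for all estimators in \<open>J\<close>, made possible by
      the zero padding of \<open>w\<close>. For empty \<open>J\<close> the value of
      \<open>Max\<close> does not matter, since all sums over \<open>J\<close> are then 0.\<close>
    define L where "L = Max J"
    have L: "N \<le> L" if "N \<in> J" for N using J(1) that by (simp add: L_def)
    have "(\<Sum>N\<in>J. c N * (\<theta>hat N \<omega> - \<theta>)) = (\<Sum>i<L. (\<Sum>N\<in>J. (c N * \<alpha>) * w N i) * S (t i) \<omega>)" for \<omega>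
    proof -
      have "(\<Sum>N\<in>J. c N * (\<theta>hat N \<omega> - \<theta>)) = (\<Sum>N\<in>J. \<Sum>i<L. (c N * \<alpha>) * w N i * S (t i) \<omega>)"
      proof (intro sum.cong refl)
        fix N assume N: "N \<in> J"
        then have "0 < N" using J by auto
        then have "c N * (\<theta>hat N \<omega> - \<theta>) = (\<Sum>i<N. (c N * \<alpha>) * w N i * S (t i) \<omega>)"
          by (simp add: \<theta>hat sum_distrib_left mult_ac)
        also have "\<dots> = (\<Sum>i<L. (c N * \<alpha>) * w N i * S (t i) \<omega>)"
          using L[OF N] by (intro sum.mono_neutral_left) (auto simp: w_def)
        finally show "c N * (\<theta>hat N \<omega> - \<theta>) = (\<Sum>i<L. (c N * \<alpha>) * w N i * S (t i) \<omega>)" .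
      qed
      then show ?thesis by (subst (asm) sum.swap) (simp add: sum_distrib_right)
    qed
    moreover have "cov L (\<lambda>i. \<Sum>N\<in>J. (c N * \<alpha>) * w N i) (\<lambda>i. \<Sum>N\<in>J. (c N * \<alpha>) * w N i) =
      (\<Sum>N\<in>J. \<Sum>K\<in>J. c N * c K * min (\<alpha>\<^sup>2 / d N) (\<alpha>\<^sup>2 / d K))"
      unfolding cov_sum
    proof (intro sum.cong refl)
      fix N K assume "N \<in> J" "K \<in> J"
      then have "cov L (w N) (w K) = min (1 / d N) (1 / d K)" using J L by (intro cov_w_w_min) auto
      moreover have "\<alpha>\<^sup>2 * min (1 / d N) (1 / d K) = min (\<alpha>\<^sup>2 / d N) (\<alpha>\<^sup>2 / d K)"
        by (simp add: min_mult_distrib_left)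
      ultimately show "c N * \<alpha> * (c K * \<alpha>) * cov L (w N) (w K) = c N * c K * min (\<alpha>\<^sup>2 / d N) (\<alpha>\<^sup>2 / d K)"
        by (simp add: power2_eq_square mult_ac)
    qed
    ultimately show ?thesis by (simp only: iexp_S)
  qed
  have meas_S: "S (t i) \<in> borel_measurable M" for i
    unfolding S_def using fbm_integrable(1)[OF B order_refl, of _ "t i"] t[of i]
    by (intro borel_measurable_sum borel_measurable_integrable) (simp add: less_imp_le)
  have meas: "(\<lambda>\<omega>. \<theta>hat N \<omega> - \<theta>) \<in> borel_measurable M" if "0 < N" for N
    unfolding \<theta>hat[OF that] by (intro borel_measurable_sum borel_measurable_times borel_measurable_const meas_S)
  have v: "v N = \<alpha>\<^sup>2 / d N" if N: "0 < N" for N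
  proof -
    have pos: "0 < \<alpha>\<^sup>2 / d N" using \<alpha> d_pos[OF N] by simp
    \<comment> \<open>The normal law is identified from the characteristic function, and the mean
      and variance of the estimator are read off from that law.\<close>
    have n: "distributed M lborel (\<lambda>\<omega>. \<theta>hat N \<omega> - \<theta>) (normal_density 0 (sqrt (\<alpha>\<^sup>2 / d N)))"
    proof (rule distributed_normalI_iexp[OF meas[OF N]])
      show "0 < sqrt (\<alpha>\<^sup>2 / d N)" using pos by simp
      fix c :: real
      show "expectation (\<lambda>\<omega>. iexp (c * (\<theta>hat N \<omega> - \<theta>))) = exp (- (c\<^sup>2 * (sqrt (\<alpha>\<^sup>2 / d N))\<^sup>2) / 2)"
        using iexp_\<theta>hat[of "{N}" "\<lambda>_. c"] N pos by (simp add: power2_eq_square[of c])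
    qed
    have s: "0 < sqrt (\<alpha>\<^sup>2 / d N)" using pos by simp
    have i: "integrable M (\<lambda>\<omega>. \<theta>hat N \<omega> - \<theta>)" by (rule normal_square_integrable[OF n s])
    have "expectation (\<theta>hat N) = expectation (\<lambda>\<omega>. (\<theta>hat N \<omega> - \<theta>) + \<theta>)" by simp
    also have "\<dots> = expectation (\<lambda>\<omega>. \<theta>hat N \<omega> - \<theta>) + \<theta>"
      using i by (subst Bochner_Integration.integral_add) (auto simp: prob_space)
    also have "expectation (\<lambda>\<omega>. \<theta>hat N \<omega> - \<theta>) = 0" by (rule normal_distributed_expectation[OF s n])
    finally have "expectation (\<theta>hat N) = \<theta>" by simp
    then show ?thesis
      using normal_distributed_variance[OF s n] normal_distributed_expectation[OF s n] pos by (simp add: v_def)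
  qed
  have "antimono_on {1..} v"
  proof (rule monotone_onI)
    fix N K :: nat assume NK: "N \<in> {1..}" "K \<in> {1..}" "N \<le> K"
    then have "\<alpha>\<^sup>2 * (1 / d K) \<le> \<alpha>\<^sup>2 * (1 / d N)" by (intro mult_left_mono inverse_d_antimono) auto
    then show "v K \<le> v N" using NK by (simp add: v)
  qed
  moreover have "v \<longlonglongrightarrow> 0"
  \<comment> \<open>The formula for \<open>v\<close> holds from index 1 on and
    \<open>inverse_d_le\<close> bounds index \<open>Suc N\<close>, hence the shift.\<close>
  proof (rule LIMSEQ_imp_Suc, rule tendsto_sandwich)
    show "\<forall>\<^sub>F N in sequentially. 0 \<le> v (Suc N)" by (simp add: v d_pos less_imp_le)
    show "\<forall>\<^sub>F N in sequentially. v (Suc N) \<le> \<alpha>\<^sup>2 * (\<Sum>r=1..m. t N powr (2 * H r - 2))"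
    proof (intro always_eventually allI)
      fix N
      \<comment> \<open>On the diagonal the kernel of each process is
        \<open>t N powr (2 * H r)\<close>; division by the squared time leaves a negative exponent
        because \<open>H r < 1\<close>.\<close>
      have "\<Gamma> N N / (t N)\<^sup>2 = (\<Sum>r=1..m. t N powr (2 * H r - 2))"
        using t[of N] by (simp add: \<Gamma>_def fbm_cov_def sum_divide_distrib powr_diff powr_numeral)
      then have "\<alpha>\<^sup>2 * (1 / d (Suc N)) \<le> \<alpha>\<^sup>2 * (\<Sum>r=1..m. t N powr (2 * H r - 2))"
        using inverse_d_le[of N] by (intro mult_left_mono) auto
      then show "v (Suc N) \<le> \<alpha>\<^sup>2 * (\<Sum>r=1..m. t N powr (2 * H r - 2))" by (simp add: v)
    qed
    have "filterlim t at_top sequentially"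
      unfolding t_def[abs_def] grid_time_def using h by real_asymp
    then have "(\<lambda>N. t N powr (2 * H r - 2)) \<longlonglongrightarrow> 0" if "r \<in> {1..m}" for r
      using H[OF that] by (intro tendsto_neg_powr) auto
    then have "(\<lambda>N. \<alpha>\<^sup>2 * (\<Sum>r=1..m. t N powr (2 * H r - 2))) \<longlonglongrightarrow> \<alpha>\<^sup>2 * (\<Sum>r=1..m. 0)"
      by (intro tendsto_intros)
    then show "(\<lambda>N. \<alpha>\<^sup>2 * (\<Sum>r=1..m. t N powr (2 * H r - 2))) \<longlonglongrightarrow> 0" by simp
  qed simp
  moreover have "\<exists>(M' :: (real \<Rightarrow> real) measure) W.
       prob_space M' \<and> prob_space.standard_brownian_motion M' W \<and>
       distr M (PiM {1..} (\<lambda>_. borel)) (\<lambda>\<omega>. \<lambda>N\<in>{1..}. \<theta>hat N \<omega> - \<theta>) =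
       distr M' (PiM {1..} (\<lambda>_. borel)) (\<lambda>\<omega>. \<lambda>N\<in>{1..}. W (v N) \<omega>)"
  proof -
    obtain M' :: "(real \<Rightarrow> real) measure" and \<xi> where noise: "white_noise M' \<xi>"
      using white_noise_exists by blast
    interpret W: white_noise M' \<xi> by (rule noise)
    have "distr M (PiM {1..} (\<lambda>_. borel)) (\<lambda>\<omega>. \<lambda>N\<in>{1..}. \<theta>hat N \<omega> - \<theta>) =
       distr M' (PiM {1..} (\<lambda>_. borel)) (\<lambda>\<omega>. \<lambda>N\<in>{1..}. W.wiener (v N) \<omega>)"
    proof (rule Cramer_Wold)
      fix J :: "nat set" and c :: "nat \<Rightarrow> real" assume J: "finite J" "J \<subseteq> {1..}"
      have vJ: "v N = \<alpha>\<^sup>2 / d N" "0 \<le> v N" if "N \<in> J" for N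
        using that J d_pos[of N] by (auto simp: v subset_eq Suc_le_eq less_imp_le)
      have "W.expectation (\<lambda>\<omega>. iexp (\<Sum>N\<in>J. c N * W.wiener (v N) \<omega>)) =
          exp (- (\<Sum>N\<in>J. \<Sum>K\<in>J. c N * c K * min (v N) (v K)) / 2)"
        by (rule W.expectation_iexp_wiener[OF J(1)]) (rule vJ)
      also have "(\<Sum>N\<in>J. \<Sum>K\<in>J. c N * c K * min (v N) (v K)) = (\<Sum>N\<in>J. \<Sum>K\<in>J. c N * c K * min (\<alpha>\<^sup>2 / d N) (\<alpha>\<^sup>2 / d K))"
        by (simp add: vJ(1) cong: sum.cong)
      finally show "expectation (\<lambda>\<omega>. iexp (\<Sum>N\<in>J. c N * (\<theta>hat N \<omega> - \<theta>))) =
          W.expectation (\<lambda>\<omega>. iexp (\<Sum>N\<in>J. c N * W.wiener (v N) \<omega>))"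
        by (simp only: iexp_\<theta>hat[OF J])
    qed (use meas prob_space_axioms W.prob_space_axioms in auto)
    then show ?thesis using W.prob_space_axioms W.standard_brownian_motion_wiener by blast
  qed
  ultimately show ?thesis by blast
qed

end
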